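(* Consider the causal adversarial multi-path network model described in the context, with $C$ links of unit capacity, additive jamming, no feedback and no secrecy requirement. For any adversary vector $\vec z=(z_{rw},z_{ro},z_{wo})$ with nonnegative integer entries and $z_{rw}+z_{ro}+z_{wo}\le C$, the capacity (maximum achievable reliable rate) is $$R^{add}_j(C,\vec z)=\begin{cases} C-(z_{rw}+z_{wo}) & \text{if } z_{wo}+2z_{rw}<C,\\ 0 & \text{otherwise.}\end{cases}$$
   Context: Model. A sender (Alice) communicates with a receiver (Bob) over $C$ parallel directed noiseless links $L_1,\dots,L_C$; in the equal-capacity case each link has unit capacity: over a block of $n$ time slots each link carries a length-$n$ word (one unit of information per time slot; the links are taken in the large-alphabet regime, i.e. symbols may be grouped into elements of finite fields $\mathbb F_{2^b}$ with $b$ growing with $n$). A code of block length $n$ and rate $R$ has message $M$ uniform on $\{0,1\}^{nR}$; the encoder is stochastic, using private randomness of Alice unknown to the adversary, and maps the message and randomness to codewords $\vec X_1,\dots,\vec X_C$ (row $i$ sent on $L_i$). The decoder maps the received words $\vec Y_1,\dots,\vec Y_C$ to an estimate $\hat M$. Adversary. An adversary (Calvin), who knows the encoder and decoder, selects pairwise disjoint link sets $Z_{rw},Z_{ro},Z_{wo}$ (unknown to Alice and Bob) with $|Z_{rw}|\le z_{rw}$, $|Z_{ro}|\le z_{ro}$, $|Z_{wo}|\le z_{wo}$; he can read (eavesdrop) the links in $Z_r=Z_{rw}\cup Z_{ro}$ and write (jam) the links in $Z_w=Z_{rw}\cup Z_{wo}$. Write $z_r=z_{rw}+z_{ro}$,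 $z_w=z_{rw}+z_{wo}$, $\vec z=(z_{rw},z_{ro},z_{wo})$. The adversary is causal: at each time $t$ his jamming of the $t$-th symbols of links in $Z_w$ may depend only on the first $t$ symbols observed on the links in $Z_r$ (and his own randomness). Under additive jamming, the received word on link $i$ is $\vec Y_i=\vec X_i+\vec E_i$ where $\vec E_i$ is chosen by Calvin and $\vec E_i=0$ for $i\notin Z_w$. Under overwrite jamming, $\vec Y_i=\vec E_i$ for $i\in Z_w$ (Calvin replaces the symbols by his own) and $\vec Y_i=\vec X_i$ otherwise. Reliability and capacity. Rate $R$ is achievable if for every $\varepsilon>0$ and all sufficiently large $n$ there is a code of block length $n$ and rate $R$ with $\Pr[\hat M\neq M]<\varepsilon$ against every admissible causal adversary strategy; the capacity is the supremum of achievable rates. (Without feedback, the encoder's output depends only on the message and Alice's randomness.) *)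

theory Defs
  imports "HOL-Probability.Probability"
begin

text \<open>
  Words on the C links over n time slots are functions  X :: nat => nat => nat,
  X i t = symbol on link i (i < C) at time t (t < n).  Symbols are elements of
  GF(2^b), represented by naturals < 2^b; field addition is bitwise xor.
\<close>

type_synonym word = "nat \<Rightarrow> nat \<Rightarrow> nat"

text \<open>A deterministic adversary strategy: (Z_rw, Z_ro, Z_wo, J), where J maps the
  transmitted word to the additive error word.  Calvin's private randomness is
  modelled by a probability distribution (pmf) over such strategies.\<close>

type_synonym strategy = "nat set \<times> nat set \<times> nat set \<times> (word \<Rightarrow> word)"

definition valid_word :: "nat \<Rightarrow> nat \<Rightarrow> nat \<Rightarrow> word \<Rightarrow> bool" where
  "valid_word C n b X \<longleftrightarrow>
     (\<forall>i t. X i t < 2 ^ b) \<and> (\<forall>i t. (C \<le> i \<or> n \<le> t) \<longrightarrow> X i t = 0)"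

definition admissible_strategy ::
  "nat \<Rightarrow> nat \<Rightarrow> nat \<Rightarrow> nat \<times> nat \<times> nat \<Rightarrow> strategy \<Rightarrow> bool" where
  "admissible_strategy C n b z s \<longleftrightarrow>
     (case z of (zrw, zro, zwo) \<Rightarrow> case s of (Zrw, Zro, Zwo, J) \<Rightarrow>
        Zrw \<subseteq> {..<C} \<and> Zro \<subseteq> {..<C} \<and> Zwo \<subseteq> {..<C}
      \<and> Zrw \<inter> Zro = {} \<and> Zrw \<inter> Zwo = {} \<and> Zro \<inter> Zwo = {}
      \<and> card Zrw \<le> zrw \<and> card Zro \<le> zro \<and> card Zwo \<le> zwo
      \<comment> \<open>error symbols lie in the alphabet\<close>
      \<and> (\<forall>X i t. J X i t < 2 ^ b)
      \<comment> \<open>only the links in Z_w = Z_rw \<union> Z_wo are jammed\<close>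
      \<and> (\<forall>X i t. i \<notin> Zrw \<union> Zwo \<longrightarrow> J X i t = 0)
      \<comment> \<open>causality: the jamming at time t depends only on the symbols at times
          0..t observed on the links in Z_r = Z_rw \<union> Z_ro\<close>
      \<and> (\<forall>X X' t. (\<forall>j \<in> Zrw \<union> Zro. \<forall>s \<le> t. X j s = X' j s)
                  \<longrightarrow> (\<forall>i. J X i t = J X' i t)))"

definition received :: "nat \<Rightarrow> nat \<Rightarrow> word \<Rightarrow> word \<Rightarrow> word" where
  "received C n X E = (\<lambda>i t. if i < C \<and> t < n then xor (X i t) (E i t) else 0)"

text \<open>Number of messages of a rate-R code with block length n over GF(2^b):
  rate is measured in link-symbol units (one unit per link per time slot).\<close>
definition num_msgs :: "nat \<Rightarrow> nat \<Rightarrow> real \<Rightarrow> nat" where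
  "num_msgs n b R = nat \<lceil>(2::real) powr (real b * real n * R)\<rceil>"

text \<open>A code: stochastic encoder (a distribution of codewords per message,
  Alice's private randomness) and deterministic decoder.\<close>
definition valid_code ::
  "nat \<Rightarrow> nat \<Rightarrow> nat \<Rightarrow> (nat \<Rightarrow> word pmf) \<Rightarrow> bool" where
  "valid_code C n b enc \<longleftrightarrow> (\<forall>msg X. X \<in> set_pmf (enc msg) \<longrightarrow> valid_word C n b X)"

definition err_prob ::
  "nat \<Rightarrow> nat \<Rightarrow> nat \<Rightarrow> (nat \<Rightarrow> word pmf) \<Rightarrow> (word \<Rightarrow> nat) \<Rightarrow> strategy pmf \<Rightarrow> real" where
  "err_prob C n m enc dec A =
     (\<Sum>msg<m. measure_pmf.prob (pair_pmf (enc msg) A)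
        {(X, s). dec (received C n X ((snd (snd (snd s))) X)) \<noteq> msg}) / real m"

definition admissible_adversary ::
  "nat \<Rightarrow> nat \<Rightarrow> nat \<Rightarrow> nat \<times> nat \<times> nat \<Rightarrow> strategy pmf \<Rightarrow> bool" where
  "admissible_adversary C n b z A \<longleftrightarrow> (\<forall>s \<in> set_pmf A. admissible_strategy C n b z s)"

definition achievable_add :: "nat \<Rightarrow> nat \<times> nat \<times> nat \<Rightarrow> real \<Rightarrow> bool" where
  "achievable_add C z R \<longleftrightarrow> 0 \<le> R \<and>
     (\<forall>\<epsilon>>0. \<exists>N. \<forall>n\<ge>N. \<exists>b\<ge>1. \<exists>enc dec.
        valid_code C n b enc \<and>
        (\<forall>A. admissible_adversary C n b z A \<longrightarrow>
              err_prob C n (num_msgs n b R) enc dec A < \<epsilon>))"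

definition capacity_add :: "nat \<Rightarrow> nat \<times> nat \<times> nat \<Rightarrow> ereal" where
  "capacity_add C z = Sup (ereal ` {R. achievable_add C z R})"

end

theory Submission
  imports Defs "HOL-Algebra.Algebraic_Closure_Type" "HOL-Library.Z2"
begin

text \<open>
  Converse. Uniform noise on \<open>z\<^sub>r\<^sub>w + z\<^sub>w\<^sub>o\<close> links spreads every codeword uniformly over a coset of the
  noise space, so a decoder is right for at most \<open>|received words| / |noise words|\<close> messages on
  average; this gives the rate bound. If \<open>C \<le> z\<^sub>w\<^sub>o + 2 z\<^sub>r\<^sub>w\<close>, the links split into \<open>S\<close>, \<open>T\<close>, \<open>Z\<close>, and Calvin
  drowns \<open>Z\<close> in noise while replacing \<open>S\<close> (or \<open>T\<close>) by the corresponding rows of a codeword of a random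
  message: Bob sees the same distribution whichever of the two messages is the true one.

  Achievability. A Reed-Solomon code over \<open>GF(2^b)\<close> with \<open>k = C - (z\<^sub>r\<^sub>w + z\<^sub>w\<^sub>o)\<close> lets any \<open>k\<close> correct links
  determine the message. At the very end of the block each link sends a private random key, the cube
  of the key and the polynomial hashes of all links under that key; Bob trusts a link if at least
  \<open>k\<close> links vouch for it. By causality the keys are unknown when the message part is jammed,
  and on a write-only link a nonzero shift of the key is betrayed by the cube, so only the at
  most \<open>z\<^sub>r\<^sub>w < k\<close> read-write links can vouch for a corrupted link.
\<close>

section \<open>Finite fields of characteristic 2 with xor as addition\<close>

lemma xor_less_power_of_2:
  fixes x y :: nat
  assumes "x < 2 ^ b" "y < 2 ^ b"
  shows "xor x y < 2 ^ b"
proof -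
  have "take_bit b (xor x y) = xor x y"
    using assms by (simp add: take_bit_nat_eq_self)
  thus ?thesis
    by (metis take_bit_nat_less_exp)
qed

text \<open>The fixed points are the roots of X^(2^m) - X. This polynomial splits over an
  algebraically closed field, and in characteristic 2 its derivative is the constant -1, so no root
  is repeated and there are as many roots as the degree.\<close>

lemma card_fixed_points_Frobenius:
  assumes char: "CHAR('a :: alg_closed_field) = 2" and m: "m > 0"
  shows "card {x :: 'a. x ^ (2 ^ m) = x} = 2 ^ m"
proof -
  define p :: "'a poly" where "p = Polynomial.monom 1 (2 ^ m) - [:0, 1:]"
  have two: "(2::'a) = 0"
    using char of_nat_CHAR[where 'a = 'a] by simp
  have gt: "(2::nat) ^ m > 1"
    using m by (intro one_less_power) auto
  have deg: "Polynomial.degree p = 2 ^ m"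
    unfolding p_def using gt
    by (subst diff_conv_add_uminus, subst degree_add_eq_left) (simp_all add: Polynomial.degree_monom_eq)
  have nz: "p \<noteq> 0"
    using deg gt by (metis degree_0 not_less_zero less_trans zero_less_one)
  have poly_p: "poly p x = x ^ (2 ^ m) - x" for x
    by (simp add: p_def Polynomial.poly_monom)
  have der: "pderiv p = [:-1:]"
    using m by (simp add: p_def pderiv_diff pderiv_monom two pderiv_pCons power_0_left)
  obtain A where A: "size A = Polynomial.degree p"
      "p = Polynomial.smult (Polynomial.lead_coeff p) (\<Prod>x\<in>#A. [:-x, 1:])"
    using alg_closed_imp_factorization[OF nz] by blast
  have lc: "Polynomial.lead_coeff p \<noteq> 0"
    using nz by simp
  have roots: "{x. poly p x = 0} = set_mset A"
  proof -
    have "poly p x = Polynomial.lead_coeff p * (\<Prod>y\<in>#A. x - y)" for x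
      by (subst A(2)) (simp add: poly_prod_mset)
    thus ?thesis
      using lc by (auto simp: prod_mset_zero_iff)
  qed
  have "count A x \<le> 1" for x
  proof (rule ccontr)
    assume "\<not> count A x \<le> 1"
    hence "{#x, x#} \<subseteq># A"
      by (simp add: subseteq_mset_def)
    then obtain B where "A = {#x, x#} + B"
      by (metis subset_mset.le_iff_add)
    hence "p = [:-x, 1:] * ([:-x, 1:] * Polynomial.smult (Polynomial.lead_coeff p) (\<Prod>x\<in>#B. [:-x, 1:]))"
      using A(2) by (simp add: mult.left_commute)
    then obtain q where q: "p = [:-x, 1:] * ([:-x, 1:] * q)"
      by blast
    have "poly (pderiv p) x = 0"
      by (subst q, subst pderiv_mult, subst pderiv_mult) simp
    thus False
      by (simp add: der)
  qed
  hence "mset_set (set_mset A) = A"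
    by (intro multiset_eqI) (metis One_nat_def count_eq_zero_iff count_mset_set(1) count_mset_set(3) finite_set_mset le_SucE le_zero_eq)
  hence "card (set_mset A) = size A"
    by (metis size_mset_set)
  moreover have "{x. x ^ (2 ^ m) = x} = set_mset A"
    using roots by (simp add: poly_p)
  ultimately show ?thesis
    using A(1) deg by simp
qed

text \<open>An F_2-basis is built one vector at a time: \<open>H\<close> is the span of
  \<open>i\<close> vectors and \<open>e\<close> reads off the coordinates as the bits of a number.
  Triviality of the kernel is carried along so that injectivity follows at the end.\<close>

lemma additive_xor_embedding:
  fixes S :: "'a :: ring_1 set"
  assumes two: "(2::'a) = 0" and fin: "finite S" and zero: "0 \<in> S"
    and add: "\<forall>x\<in>S. \<forall>y\<in>S. x + y \<in> S"
    and i: "2 ^ i \<le> card S"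
  shows "\<exists>H (e :: 'a \<Rightarrow> nat). H \<subseteq> S \<and> 0 \<in> H \<and> card H = 2 ^ i
           \<and> (\<forall>x\<in>H. \<forall>y\<in>H. x + y \<in> H \<and> e (x + y) = xor (e x) (e y))
           \<and> (\<forall>x\<in>H. e x < 2 ^ i \<and> (e x = 0 \<longrightarrow> x = 0))"
  using i
proof (induction i)
  case 0
  show ?case
    by (intro exI[of _ "{0}"] exI[of _ "\<lambda>_. 0"]) (use zero in auto)
next
  case (Suc i)
  have "2 ^ i \<le> card S"
    using Suc.prems by simp
  from Suc.IH[OF this] obtain H and e :: "'a \<Rightarrow> nat" where H: "H \<subseteq> S" "0 \<in> H" "card H = 2 ^ i"
    and *: "\<forall>x\<in>H. \<forall>y\<in>H. x + y \<in> H \<and> e (x + y) = xor (e x) (e y)"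
      "\<forall>x\<in>H. e x < 2 ^ i \<and> (e x = 0 \<longrightarrow> x = 0)"
    by (elim exE conjE)
  have clo: "x + y \<in> H" and hom: "e (x + y) = xor (e x) (e y)" if "x \<in> H" "y \<in> H" for x y
    using * that by blast+
  have lt: "e x < 2 ^ i" and ker: "e x = 0 \<Longrightarrow> x = 0" if "x \<in> H" for x
    using * that by blast+
  have "H \<noteq> S"
    using H(3) Suc.prems by auto
  then obtain v where v: "v \<in> S" "v \<notin> H"
    using H(1) by blast
  have dbl: "x + x = 0" for x :: 'a
    using two by (metis mult_2 mult_zero_left)
  have dbl': "x + (x + y) = y" for x y :: 'a
    by (metis add.assoc add_0 dbl)
  have finH: "finite H"
    using fin H(1) finite_subset by blast
  define H' where "H' = H \<union> (+) v ` H"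
  \<comment> \<open>Bit \<open>i\<close> is still free because \<open>e\<close> stays below
    \<open>2 ^ i\<close> on \<open>H\<close>, so it can mark the coset \<open>v + H\<close>. Adding
    \<open>v\<close> once more undoes the shift, since \<open>x + x = 0\<close>.\<close>
  define e' where "e' x = (if x \<in> H then e x else xor (2 ^ i) (e (v + x)))" for x
  have vH: "v + x \<notin> H" if "x \<in> H" for x
  proof
    assume "v + x \<in> H"
    hence "v + x + x \<in> H" using that clo by blast
    thus False using v by (simp add: add.assoc dbl)
  qed
  have e'1: "e' x = e x" if "x \<in> H" for x
    using that by (simp add: e'_def)
  have e'2: "e' (v + x) = xor (2 ^ i) (e x)" if "x \<in> H" for x
    using that vH by (simp add: e'_def dbl')
  have "card H' = 2 ^ Suc i"
    unfolding H'_def using finH H(3) vH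
    by (subst card_Un_disjoint) (auto simp: card_image)
  moreover have "H' \<subseteq> S"
    using H(1) v add by (auto simp: H'_def)
  moreover have "0 \<in> H'"
    using H by (simp add: H'_def)
  moreover have "x + y \<in> H' \<and> e' (x + y) = xor (e' x) (e' y)" if xy: "x \<in> H'" "y \<in> H'" for x y
  proof -
    have w: "xor (xor a c) (xor a d) = xor c d" "xor c (xor a d) = xor a (xor c d)" for a c d :: nat
      by (metis xor.assoc xor.commute xor.left_neutral xor_self_eq) (metis xor.assoc xor.commute)
    have r: "v + x + (v + y) = x + y" "x + (v + y) = v + (x + y)" for x y
      by (metis add.assoc add.commute dbl') (metis add.assoc add.commute)
    consider "x \<in> H" "y \<in> H" | y' where "x \<in> H" "y' \<in> H" "y = v + y'"
      | x' where "x' \<in> H" "y \<in> H" "x = v + x'"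
      | x' y' where "x' \<in> H" "y' \<in> H" "x = v + x'" "y = v + y'"
      using xy unfolding H'_def by blast
    thus ?thesis
    proof cases
      case 1
      thus ?thesis by (simp add: H'_def e'1 clo hom)
    next
      case 2
      thus ?thesis by (simp only: r(2)) (simp add: H'_def e'1 e'2 clo hom w)
    next
      case 3
      thus ?thesis by (simp only: add.assoc) (simp add: H'_def e'1 e'2 clo hom xor.assoc)
    next
      case 4
      thus ?thesis by (simp only: r(1) e'2 w(1)) (simp add: H'_def e'1 clo hom)
    qed
  qed
  moreover have "e' x < 2 ^ Suc i" if "x \<in> H'" for x
  proof -
    have "e y < 2 ^ Suc i" if "y \<in> H" for y
      using lt[OF that] by simp
    thus ?thesis
      using that unfolding H'_def
      by (elim UnE imageE) (simp_all only: e'1 e'2, intro xor_less_power_of_2, simp_all)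
  qed
  moreover have "x = 0" if "x \<in> H'" "e' x = 0" for x
  proof -
    have "xor (2 ^ i) (e y) \<noteq> 0" if "y \<in> H" for y
    proof
      assume "xor (2 ^ i) (e y) = 0"
      hence "e y = 2 ^ i"
        by (metis xor.assoc xor.left_neutral xor.right_neutral xor_self_eq)
      thus False using lt[OF that] by simp
    qed
    thus ?thesis
      using that ker unfolding H'_def by (elim UnE imageE) (metis e'1, metis e'2)
  qed
  ultimately show ?case
    by (intro exI[of _ H'] exI[of _ e']) auto
qed

lemma exists_additive_xor_bijection:
  fixes S :: "'a :: ring_1 set"
  assumes two: "(2::'a) = 0" and zero: "0 \<in> S"
    and add: "\<forall>x\<in>S. \<forall>y\<in>S. x + y \<in> S"
    and card: "card S = 2 ^ b"
  shows "\<exists>e :: 'a \<Rightarrow> nat. bij_betw e S {..<2 ^ b} \<and> (\<forall>x\<in>S. \<forall>y\<in>S. e (x + y) = xor (e x) (e y))"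
proof -
  have fin: "finite S"
    using card by (intro card_ge_0_finite) simp
  from additive_xor_embedding[OF two fin zero add eq_refl[OF card[symmetric]]]
  obtain H and e :: "'a \<Rightarrow> nat" where H: "H \<subseteq> S" "card H = 2 ^ b"
    and hom: "\<forall>x\<in>H. \<forall>y\<in>H. x + y \<in> H \<and> e (x + y) = xor (e x) (e y)"
    and lt: "\<forall>x\<in>H. e x < 2 ^ b \<and> (e x = 0 \<longrightarrow> x = 0)"
    by (elim exE conjE)
  have [simp]: "H = S"
    by (rule card_subset_eq[OF fin H(1)]) (simp only: card H(2))
  have "inj_on e S"
  proof (rule inj_onI)
    fix x y assume xy: "x \<in> S" "y \<in> S" "e x = e y"
    have "x + y \<in> S" "e (x + y) = 0"
      using hom xy by auto
    hence "x + y = 0"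
      using lt by simp
    moreover have "y + y = 0"
      using two by (metis mult_2 mult_zero_left)
    ultimately show "x = y"
      by (metis add_right_cancel)
  qed
  moreover have "e ` S \<subseteq> {..<2 ^ b}"
    using lt by auto
  ultimately have "e ` S = {..<2 ^ b}"
    using card by (intro card_subset_eq) (auto simp: card_image)
  with \<open>inj_on e S\<close> have "bij_betw e S {..<2 ^ b}"
    by (simp add: bij_betw_def)
  thus ?thesis
    using hom by auto
qed

text \<open>GF(2^b) is a subset of an ambient field, not a type, because \<open>b\<close> is chosen
  inside a proof, depending on the block length. The bijection \<open>e\<close> turns field addition
  into the xor of channel symbols.\<close>

locale xor_field =
  fixes K :: "'a :: field set" and e :: "'a \<Rightarrow> nat" and b :: nat
  assumes zero_mem: "0 \<in> K" and one_mem: "1 \<in> K"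
    and add_mem: "x \<in> K \<Longrightarrow> y \<in> K \<Longrightarrow> x + y \<in> K"
    and mult_mem: "x \<in> K \<Longrightarrow> y \<in> K \<Longrightarrow> x * y \<in> K"
    and bij: "bij_betw e K {..<2 ^ b}"
    and e_add: "x \<in> K \<Longrightarrow> y \<in> K \<Longrightarrow> e (x + y) = xor (e x) (e y)"
begin

lemma finite_K: "finite K"
  using bij bij_betw_finite by blast

lemma card_K: "card K = 2 ^ b"
  using bij_betw_same_card[OF bij] by simp

definition d :: "nat \<Rightarrow> 'a" where "d = inv_into K e"

lemma d_mem: "v < 2 ^ b \<Longrightarrow> d v \<in> K"
  unfolding d_def using bij by (metis bij_betw_imp_surj_on inv_into_into lessThan_iff)

lemma e_d: "v < 2 ^ b \<Longrightarrow> e (d v) = v"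
  unfolding d_def using bij by (metis bij_betw_inv_into_right lessThan_iff)

lemma d_e: "x \<in> K \<Longrightarrow> d (e x) = x"
  unfolding d_def using bij by (metis bij_betw_inv_into_left)

lemma e_less: "x \<in> K \<Longrightarrow> e x < 2 ^ b"
  using bij by (metis bij_betwE lessThan_iff)

lemma d_inj: "v < 2 ^ b \<Longrightarrow> w < 2 ^ b \<Longrightarrow> d v = d w \<Longrightarrow> v = w"
  by (metis e_d)

lemma e_zero: "e 0 = 0"
  using e_add[OF zero_mem zero_mem] by simp

lemma d_zero: "d 0 = 0"
  using d_e[OF zero_mem] by (simp add: e_zero)

lemma double_zero: "x \<in> K \<Longrightarrow> x + x = 0"
  using e_add[of x x] add_mem[of x x] by (metis d_e e_zero xor_self_eq zero_mem)

text \<open>This turns jamming by xor into an additive error in the field.\<close>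

lemma d_xor: "x \<in> K \<Longrightarrow> v < 2 ^ b \<Longrightarrow> d (xor (e x) v) = x + d v"
  by (metis add_mem d_e d_mem e_add e_d)

lemma power_mem: "x \<in> K \<Longrightarrow> x ^ l \<in> K"
  by (induction l) (auto intro: one_mem mult_mem)

lemma sum_mem: "(\<And>l. l \<in> A \<Longrightarrow> f l \<in> K) \<Longrightarrow> sum f A \<in> K"
  by (induction A rule: infinite_finite_induct) (auto intro: zero_mem add_mem)

end

text \<open>\<open>K\<close> consists of the fixed points of the \<open>b\<close>-th power of
  Frobenius in the algebraic closure of F_2; closure under addition is the freshman's dream.\<close>

lemma exists_xor_field:
  assumes "b > 0"
  shows "\<exists>(K :: bit alg_closure set) e. xor_field K e b"
proof -
  define K where "K = {x :: bit alg_closure. x ^ (2 ^ b) = x}"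
  have bit: "CHAR(bit) = 2"
    by (rule CHAR_eqI) (simp, metis dvd_0_right even_of_nat)
  have char: "CHAR(bit alg_closure) = 2"
    using bit by simp
  have two: "(2 :: bit alg_closure) = 0"
    using char of_nat_CHAR[where 'a = "bit alg_closure"] by simp
  have card: "card K = 2 ^ b"
    unfolding K_def by (rule card_fixed_points_Frobenius[OF char assms])
  have add: "x + y \<in> K" if xy: "x \<in> K" "y \<in> K" for x y
  proof -
    have "(x + y) ^ (2 ^ b) = x ^ (2 ^ b) + y ^ (2 ^ b)"
      by (rule freshmans_dream'[where n = b]) (simp_all only: char two_is_prime_nat)
    thus ?thesis
      using xy by (simp add: K_def)
  qed
  hence add': "\<forall>x\<in>K. \<forall>y\<in>K. x + y \<in> K"
    by blast
  have zero: "0 \<in> K"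
    by (simp add: K_def power_0_left)
  have one: "1 \<in> K"
    by (simp add: K_def)
  have mult: "x * y \<in> K" if "x \<in> K" "y \<in> K" for x y
    using that by (simp add: K_def power_mult_distrib)
  from exists_additive_xor_bijection[OF two zero add' card]
  obtain e :: "bit alg_closure \<Rightarrow> nat" where
    "bij_betw e K {..<2 ^ b}" "\<forall>x\<in>K. \<forall>y\<in>K. e (x + y) = xor (e x) (e y)"
    by (elim exE conjE)
  hence "xor_field K e b"
    by unfold_locales (simp_all add: zero one add mult)
  thus ?thesis
    by blast
qed

section \<open>Converse\<close>

lemma xor_xor_cancel_left: "xor x (xor x y) = (y :: nat)"
  by (simp flip: xor.assoc)

lemma prob_bind_pmf_le:
  assumes "\<And>x. x \<in> set_pmf p \<Longrightarrow> measure_pmf.prob (f x) S \<le> c" "0 \<le> c"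
  shows "measure_pmf.prob (bind_pmf p f) S \<le> c"
proof -
  have "emeasure (bind_pmf p f) S = (\<integral>\<^sup>+x. emeasure (f x) S \<partial>p)"
    by simp
  also have "\<dots> \<le> (\<integral>\<^sup>+x. ennreal c \<partial>p)"
    using assms
    by (intro nn_integral_mono_AE) (auto simp: AE_measure_pmf_iff measure_pmf.emeasure_eq_measure)
  finally show ?thesis
    using assms(2) by (simp add: measure_pmf.emeasure_eq_measure)
qed

lemma prob_bind_pmf_of_set:
  assumes "finite S" "S \<noteq> {}"
  shows "measure_pmf.prob (bind_pmf (pmf_of_set S) f) E = (\<Sum>x\<in>S. measure_pmf.prob (f x) E) / real (card S)"
proof -
  have "emeasure (bind_pmf (pmf_of_set S) f) E = (\<Sum>x\<in>S. emeasure (f x) E) / ennreal (card S)"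
    using assms by (simp add: nn_integral_pmf_of_set ennreal_of_nat_eq_real_of_nat)
  also have "(\<Sum>x\<in>S. emeasure (f x) E) = ennreal (\<Sum>x\<in>S. measure_pmf.prob (f x) E)"
    by (simp add: measure_pmf.emeasure_eq_measure)
  also have "\<dots> / ennreal (card S) = ennreal ((\<Sum>x\<in>S. measure_pmf.prob (f x) E) / real (card S))"
    using assms by (intro divide_ennreal sum_nonneg) (auto simp: card_gt_0_iff)
  finally show ?thesis
    by (simp add: measure_pmf.emeasure_eq_measure sum_nonneg)
qed

definition words_on :: "nat set \<Rightarrow> nat \<Rightarrow> nat \<Rightarrow> word set" where
  "words_on L n b = {U. \<forall>i t. U i t < 2 ^ b \<and> (i \<notin> L \<or> n \<le> t \<longrightarrow> U i t = 0)}"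

lemma valid_word_iff: "valid_word C n b w \<longleftrightarrow> w \<in> words_on {..<C} n b"
  by (auto simp: valid_word_def words_on_def not_less)

lemma words_on_eq_image:
  "words_on L n b = curry ` PiE_dflt (L \<times> {..<n}) 0 (\<lambda>_. {..<2 ^ b})"
proof (intro equalityI subsetI)
  fix U assume "U \<in> words_on L n b"
  hence "case_prod U \<in> PiE_dflt (L \<times> {..<n}) 0 (\<lambda>_. {..<2 ^ b})"
    by (auto simp: words_on_def PiE_dflt_def)
  thus "U \<in> curry ` PiE_dflt (L \<times> {..<n}) 0 (\<lambda>_. {..<2 ^ b})"
    by (metis curry_case_prod image_eqI)
next
  fix U assume "U \<in> curry ` PiE_dflt (L \<times> {..<n}) 0 (\<lambda>_. {..<(2::nat) ^ b})"
  then obtain f where f: "U = curry f" "f \<in> PiE_dflt (L \<times> {..<n}) 0 (\<lambda>_. {..<2 ^ b})"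
    by blast
  have "U i t < 2 ^ b \<and> (i \<notin> L \<or> n \<le> t \<longrightarrow> U i t = 0)" for i t
    using f by (cases "(i, t) \<in> L \<times> {..<n}") (auto simp: PiE_dflt_def)
  thus "U \<in> words_on L n b"
    by (simp add: words_on_def)
qed

lemma finite_words_on: "finite L \<Longrightarrow> finite (words_on L n b)"
  by (auto simp: words_on_eq_image intro!: finite_imageI finite_PiE_dflt)

lemma card_words_on:
  assumes "finite L"
  shows "card (words_on L n b) = 2 ^ (b * n * card L)"
proof -
  have "inj (curry :: (nat \<times> nat \<Rightarrow> nat) \<Rightarrow> word)"
    by (metis injI case_prod_curry)
  hence "card (words_on L n b) = card (PiE_dflt (L \<times> {..<n}) 0 (\<lambda>_. {..<(2::nat) ^ b}))"
    unfolding words_on_eq_image by (intro card_image) (rule inj_on_subset, auto)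
  also have "\<dots> = (2 ^ b) ^ (card L * n)"
    using assms by (subst card_PiE_dflt) (auto simp: card_cartesian_product)
  finally show ?thesis
    by (simp add: mult_ac flip: power_mult)
qed

lemma words_on_nonempty: "words_on L n b \<noteq> {}"
proof -
  have "(\<lambda>_ _. 0) \<in> words_on L n b"
    by (simp add: words_on_def)
  thus ?thesis by blast
qed

text \<open>Errors depend on code and adversary only through this distribution of Bob's word, so two
  adversaries can be compared by comparing their outputs.\<close>

definition channel_output :: "nat \<Rightarrow> nat \<Rightarrow> (nat \<Rightarrow> word pmf) \<Rightarrow> strategy pmf \<Rightarrow> nat \<Rightarrow> word pmf" where
  "channel_output C n enc A msg =
     map_pmf (\<lambda>(w, s). received C n w (snd (snd (snd s)) w)) (pair_pmf (enc msg) A)"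

lemma err_prob_eq_channel_output:
  "err_prob C n m enc dec A =
     (\<Sum>msg<m. measure_pmf.prob (channel_output C n enc A msg) {Y. dec Y \<noteq> msg}) / real m"
  unfolding err_prob_def channel_output_def measure_map_pmf
  by (simp add: vimage_def case_prod_unfold)

lemma err_prob_eq_correct:
  assumes "m > 0"
  shows "err_prob C n m enc dec A =
     1 - (\<Sum>msg<m. measure_pmf.prob (channel_output C n enc A msg) {Y. dec Y = msg}) / real m"
proof -
  have "measure_pmf.prob p {Y. dec Y \<noteq> k} = 1 - measure_pmf.prob p {Y. dec Y = k}" for p k
    using measure_pmf.prob_compl[of "{Y. dec Y = k}" p] by (simp add: Compl_eq_Diff_UNIV[symmetric] Collect_neg_eq)
  thus ?thesis
    using assms by (simp add: err_prob_eq_channel_output sum_subtractf diff_divide_distrib)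
qed

section \<open>Uniform noise on the writable links\<close>

definition noise_adversary :: "nat set \<Rightarrow> nat set \<Rightarrow> nat \<Rightarrow> nat \<Rightarrow> strategy pmf" where
  "noise_adversary Zrw Zwo n b =
     map_pmf (\<lambda>U. (Zrw, {}, Zwo, \<lambda>_. U)) (pmf_of_set (words_on (Zrw \<union> Zwo) n b))"

lemma admissible_noise_adversary:
  assumes "Zrw \<union> Zwo \<subseteq> {..<C}" "Zrw \<inter> Zwo = {}" "card Zrw \<le> zrw" "card Zwo \<le> zwo"
  shows "admissible_adversary C n b (zrw, zro, zwo) (noise_adversary Zrw Zwo n b)"
proof -
  have "finite (words_on (Zrw \<union> Zwo) n b)"
    using assms by (intro finite_words_on) (meson finite_lessThan finite_subset)
  thus ?thesis
    using assms words_on_nonempty[of "Zrw \<union> Zwo" n b]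
    by (auto simp: admissible_adversary_def noise_adversary_def admissible_strategy_def words_on_def)
qed

text \<open>For a fixed codeword the received word is uniform on as many words as there are noise
  words. So \<open>msg\<close> is decoded with probability at most the size of its decoding region
  divided by \<open>card W\<close>, and the disjoint regions together have at most
  \<open>card V\<close> elements.\<close>

lemma err_prob_noise_adversary:
  assumes code: "valid_code C n b enc" and Z: "Zrw \<union> Zwo \<subseteq> {..<C}" and m: "m > 0"
  shows "err_prob C n m enc dec (noise_adversary Zrw Zwo n b)
           \<ge> 1 - 2 ^ (b * n * (C - card (Zrw \<union> Zwo))) / real m"
proof -
  define W where "W = words_on (Zrw \<union> Zwo) n b"
  define V where "V = words_on {..<C} n b"
  have fin: "finite (Zrw \<union> Zwo)"
    using Z finite_subset by blast
  have W: "finite W" "W \<noteq> {}" "card W = 2 ^ (b * n * card (Zrw \<union> Zwo))"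
    unfolding W_def using fin by (auto simp: finite_words_on card_words_on words_on_nonempty)
  have V: "finite V" "card V = 2 ^ (b * n * C)"
    unfolding V_def by (auto simp: finite_words_on card_words_on)
  have out: "channel_output C n enc (noise_adversary Zrw Zwo n b) msg =
      bind_pmf (enc msg) (\<lambda>w. map_pmf (received C n w) (pmf_of_set W))" for msg
    unfolding channel_output_def noise_adversary_def W_def pair_pmf_def map_pmf_def
    by (simp add: bind_assoc_pmf bind_return_pmf)
  have "measure_pmf.prob (channel_output C n enc (noise_adversary Zrw Zwo n b) msg) {Y. dec Y = msg}
          \<le> card {Y\<in>V. dec Y = msg} / card W" for msg
    unfolding out
  proof (rule prob_bind_pmf_le)
    fix w assume "w \<in> set_pmf (enc msg)"
    hence w: "w \<in> V"
      using code by (auto simp: valid_code_def valid_word_iff V_def)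
    have "card (W \<inter> received C n w -` {Y. dec Y = msg}) \<le> card {Y\<in>V. dec Y = msg}"
    proof (rule card_inj_on_le)
      show "inj_on (received C n w) (W \<inter> received C n w -` {Y. dec Y = msg})"
      proof (rule inj_onI, intro ext)
        fix U U' i t
        assume U: "U \<in> W \<inter> received C n w -` {Y. dec Y = msg}" "U' \<in> W \<inter> received C n w -` {Y. dec Y = msg}"
          and eq: "received C n w U = received C n w U'"
        show "U i t = U' i t"
        proof (cases "i < C \<and> t < n")
          case True
          have "received C n w U i t = received C n w U' i t"
            by (simp only: eq)
          thus ?thesis
            using True by (simp add: received_def) (metis xor_xor_cancel_left)
        next
          case False
          hence "i \<notin> Zrw \<union> Zwo \<or> n \<le> t"
            using Z by auto
          thus ?thesis
            using U by (auto simp: W_def words_on_def)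
        qed
      qed
    next
      show "received C n w ` (W \<inter> received C n w -` {Y. dec Y = msg}) \<subseteq> {Y \<in> V. dec Y = msg}"
        using w by (auto simp: W_def V_def words_on_def received_def intro!: xor_less_power_of_2)
    qed (use V in auto)
    thus "measure_pmf.prob (map_pmf (received C n w) (pmf_of_set W)) {Y. dec Y = msg}
            \<le> card {Y\<in>V. dec Y = msg} / card W"
      using W by (simp add: measure_pmf_of_set divide_right_mono)
  qed auto
  hence "(\<Sum>msg<m. measure_pmf.prob (channel_output C n enc (noise_adversary Zrw Zwo n b) msg) {Y. dec Y = msg})
           \<le> (\<Sum>msg<m. card {Y\<in>V. dec Y = msg} / card W)"
    by (intro sum_mono)
  also have "\<dots> = card (\<Union>msg<m. {Y\<in>V. dec Y = msg}) / card W"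
    using V by (subst card_UN_disjoint) (auto simp flip: sum_divide_distrib)
  also have "\<dots> \<le> card V / card W"
    using V(1) by (intro divide_right_mono of_nat_mono card_mono) auto
  also have "\<dots> = 2 ^ (b * n * (C - card (Zrw \<union> Zwo)))"
  proof -
    have "card (Zrw \<union> Zwo) \<le> C"
      using card_mono[OF _ Z] by simp
    hence "b * n * C = b * n * (C - card (Zrw \<union> Zwo)) + b * n * card (Zrw \<union> Zwo)"
      by (simp flip: distrib_left)
    thus ?thesis
      using W V by (simp add: power_add)
  qed
  finally show ?thesis
    using m unfolding err_prob_eq_correct[OF m]
    by (simp add: divide_right_mono)
qed

section \<open>Spoofing a second message\<close>

text \<open>The truncation is the identity on codewords; it keeps the errors in the alphabet for arbitrary
  arguments, as admissibility demands.\<close>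
definition overwrite_with :: "nat set \<Rightarrow> nat \<Rightarrow> nat \<Rightarrow> word \<Rightarrow> word \<Rightarrow> word \<Rightarrow> word" where
  "overwrite_with S n b w' U w =
     (\<lambda>i t. if i \<in> S \<and> t < n then xor (take_bit b (w i t)) (w' i t) else U i t)"

text \<open>The links of \<open>S\<close> must be read-write, as replacing a symbol means cancelling
  the one sent. Noise on \<open>Z\<close> can be added blindly, so write-only links suffice
  there.\<close>

definition spoof_adversary ::
  "nat set \<Rightarrow> nat set \<Rightarrow> nat \<Rightarrow> nat \<Rightarrow> nat \<Rightarrow> (nat \<Rightarrow> word pmf) \<Rightarrow> strategy pmf" where
  "spoof_adversary S Z n b m enc =
     bind_pmf (pmf_of_set {..<m}) (\<lambda>msg. bind_pmf (enc msg) (\<lambda>w'.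
       map_pmf (\<lambda>U. (S, {}, Z, overwrite_with S n b w' U)) (pmf_of_set (words_on Z n b))))"

lemma admissible_spoof_adversary:
  assumes "S \<union> Z \<subseteq> {..<C}" "S \<inter> Z = {}" "card S \<le> zrw" "card Z \<le> zwo"
    and code: "valid_code C n b enc" and m: "m > 0"
  shows "admissible_adversary C n b (zrw, zro, zwo) (spoof_adversary S Z n b m enc)"
  unfolding admissible_adversary_def
proof
  fix s assume s: "s \<in> set_pmf (spoof_adversary S Z n b m enc)"
  have fin: "finite (words_on Z n b)"
    using assms by (intro finite_words_on) (meson finite_lessThan finite_subset Un_upper2)
  obtain msg w' U where s: "w' \<in> set_pmf (enc msg)" "U \<in> words_on Z n b"
      "s = (S, {}, Z, overwrite_with S n b w' U)"
    using s fin words_on_nonempty[of Z n b] m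
    by (auto simp: spoof_adversary_def lessThan_empty_iff)
  have w': "w' \<in> words_on {..<C} n b"
    using code s by (auto simp: valid_code_def valid_word_iff)
  have "overwrite_with S n b w' U w i t < 2 ^ b" for w i t
    using w' s(2) by (auto simp: overwrite_with_def words_on_def intro!: xor_less_power_of_2)
  moreover have "overwrite_with S n b w' U w i t = 0" if "i \<notin> S \<union> Z" for w i t
    using that s(2) by (auto simp: overwrite_with_def words_on_def)
  \<comment> \<open>Causality: cancelling a symbol on \<open>S\<close> uses only that symbol, which
    is observed in the same time slot.\<close>
  moreover have "overwrite_with S n b w' U w i t = overwrite_with S n b w' U Y i t"
    if "\<forall>j\<in>S \<union> {}. \<forall>s\<le>t. w j s = Y j s" for w Y i t
    using that by (auto simp: overwrite_with_def)
  ultimately show "admissible_strategy C n b (zrw, zro, zwo) s"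
    using assms unfolding s(3) admissible_strategy_def by auto
qed

text \<open>This is Bob's view under spoofing. It is unchanged when \<open>S\<close> with
  \<open>w'\<close> and \<open>T\<close> with \<open>w\<close> trade places, which is the source of
  the ambiguity.\<close>

definition splice_words :: "nat set \<Rightarrow> nat set \<Rightarrow> word \<Rightarrow> word \<Rightarrow> word \<Rightarrow> word" where
  "splice_words S T w' w U = (\<lambda>i. if i \<in> S then w' i else if i \<in> T then w i else U i)"

text \<open>On \<open>S\<close> the true rows cancel; on \<open>Z\<close> they are absorbed, because
  the xor of a fixed word with uniform noise is again uniform.\<close>

lemma channel_output_spoof_adversary:
  assumes part: "S \<union> T \<union> Z = {..<C}" "S \<inter> T = {}" "S \<inter> Z = {}" "T \<inter> Z = {}"
    and code: "valid_code C n b enc"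
  shows "channel_output C n enc (spoof_adversary S Z n b m enc) msg =
     bind_pmf (pmf_of_set {..<m}) (\<lambda>msg'. bind_pmf (enc msg) (\<lambda>w. bind_pmf (enc msg') (\<lambda>w'.
       map_pmf (splice_words S T w' w) (pmf_of_set (words_on Z n b)))))"
proof -
  have fin: "finite (words_on Z n b)"
    using part by (intro finite_words_on) (metis finite_Un finite_lessThan)
  have shift: "map_pmf (\<lambda>U. received C n w (overwrite_with S n b w' U w)) (pmf_of_set (words_on Z n b))
      = map_pmf (splice_words S T w' w) (pmf_of_set (words_on Z n b))"
    if "w \<in> set_pmf (enc msg)" "w' \<in> set_pmf (enc msg')" for w w' msg'
  proof -
    have w: "w \<in> words_on {..<C} n b" "w' \<in> words_on {..<C} n b"
      using that code by (auto simp: valid_code_def valid_word_iff)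
    \<comment> \<open>\<open>h\<close> is an involution of the noise words, hence preserves their
      uniform distribution.\<close>
    define h where "h U = (\<lambda>i t. if i \<in> Z \<and> t < n then xor (w i t) (U i t) else 0)" for U :: word
    have hh: "h (h U) = U" if "U \<in> words_on Z n b" for U
      using that by (intro ext) (auto simp: h_def words_on_def xor_xor_cancel_left)
    have hW: "h U \<in> words_on Z n b" if "U \<in> words_on Z n b" for U
      using that w by (auto simp: h_def words_on_def intro!: xor_less_power_of_2)
    have "bij_betw h (words_on Z n b) (words_on Z n b)"
      by (rule bij_betw_byWitness[where f' = h]) (use hh hW in auto)
    hence "map_pmf h (pmf_of_set (words_on Z n b)) = pmf_of_set (words_on Z n b)"
      by (intro map_pmf_of_set_bij_betw fin words_on_nonempty)
    hence "map_pmf (splice_words S T w' w) (pmf_of_set (words_on Z n b))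
        = map_pmf (\<lambda>U. splice_words S T w' w (h U)) (pmf_of_set (words_on Z n b))"
      by (metis (no_types, lifting) map_pmf_comp map_pmf_cong)
    also have "\<dots> = map_pmf (\<lambda>U. received C n w (overwrite_with S n b w' U w)) (pmf_of_set (words_on Z n b))"
    proof (rule map_pmf_cong[OF refl], intro ext)
      fix U i t assume "U \<in> set_pmf (pmf_of_set (words_on Z n b))"
      hence U: "U \<in> words_on Z n b"
        using fin words_on_nonempty by simp
      have wb: "take_bit b (w i t) = w i t"
        using w by (intro take_bit_nat_eq_self) (auto simp: words_on_def)
      have iC: "i < C \<longleftrightarrow> i \<in> S \<or> i \<in> T \<or> i \<in> Z"
        using part(1) by (metis Un_iff lessThan_iff)
      have disj: "i \<in> S \<Longrightarrow> i \<notin> T \<and> i \<notin> Z" "i \<in> T \<Longrightarrow> i \<notin> Z"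
        using part(2-4) by auto
      have U0: "i \<notin> Z \<Longrightarrow> U i t = 0" "n \<le> t \<Longrightarrow> w i t = 0" "n \<le> t \<Longrightarrow> w' i t = 0"
        using U w by (auto simp: words_on_def)
      show "splice_words S T w' w (h U) i t = received C n w (overwrite_with S n b w' U w) i t"
        using disj U0 iC
        by (auto simp: splice_words_def received_def overwrite_with_def h_def wb xor_xor_cancel_left not_less)
    qed
    finally show ?thesis ..
  qed
  have "channel_output C n enc (spoof_adversary S Z n b m enc) msg =
     bind_pmf (enc msg) (\<lambda>w. bind_pmf (pmf_of_set {..<m}) (\<lambda>msg'. bind_pmf (enc msg') (\<lambda>w'.
       map_pmf (\<lambda>U. received C n w (overwrite_with S n b w' U w)) (pmf_of_set (words_on Z n b)))))"
    unfolding channel_output_def spoof_adversary_def pair_pmf_def map_pmf_def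
    by (simp add: bind_assoc_pmf bind_return_pmf)
  also have "\<dots> = bind_pmf (enc msg) (\<lambda>w. bind_pmf (pmf_of_set {..<m}) (\<lambda>msg'. bind_pmf (enc msg') (\<lambda>w'.
       map_pmf (splice_words S T w' w) (pmf_of_set (words_on Z n b)))))"
    by (intro bind_pmf_cong refl shift)
  finally show ?thesis
    by (subst bind_commute_pmf)
qed

text \<open>\<open>Q k k'\<close> is the output for true message \<open>k\<close> and fake message
  \<open>k'\<close> when \<open>S\<close> is spoofed, and also for true message \<open>k'\<close>
  and fake message \<open>k\<close> when \<open>T\<close> is spoofed. If \<open>k\<close> and
  \<open>k'\<close> differ, every decision is wrong in at least one of the two situations; the pairs
  with \<open>k = k'\<close> account for the loss of \<open>1 / m\<close>.\<close>

lemma err_prob_spoof_adversaries: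
  assumes part: "S \<union> T \<union> Z = {..<C}" "S \<inter> T = {}" "S \<inter> Z = {}" "T \<inter> Z = {}"
    and code: "valid_code C n b enc" and m: "m > 0"
  shows "err_prob C n m enc dec (spoof_adversary S Z n b m enc)
       + err_prob C n m enc dec (spoof_adversary T Z n b m enc) \<ge> 1 - 1 / real m"
proof -
  define Q where "Q k k' = bind_pmf (enc k) (\<lambda>w. bind_pmf (enc k') (\<lambda>w'.
       map_pmf (splice_words S T w' w) (pmf_of_set (words_on Z n b))))" for k k'
  have out1: "channel_output C n enc (spoof_adversary S Z n b m enc) k = bind_pmf (pmf_of_set {..<m}) (Q k)" for k
    unfolding Q_def by (rule channel_output_spoof_adversary[OF part code])
  have swap: "splice_words T S w' w = splice_words S T w w'" for w w'
    using part(2) by (auto simp: splice_words_def fun_eq_iff)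
  have out2: "channel_output C n enc (spoof_adversary T Z n b m enc) k = bind_pmf (pmf_of_set {..<m}) (\<lambda>k'. Q k' k)" for k
  proof -
    have "T \<union> S \<union> Z = {..<C}" "T \<inter> S = {}"
      using part by auto
    from channel_output_spoof_adversary[OF this part(4,3) code]
    have "channel_output C n enc (spoof_adversary T Z n b m enc) k =
      bind_pmf (pmf_of_set {..<m}) (\<lambda>k'. bind_pmf (enc k) (\<lambda>w. bind_pmf (enc k') (\<lambda>w'.
       map_pmf (splice_words S T w w') (pmf_of_set (words_on Z n b)))))"
      unfolding swap .
    also have "\<dots> = bind_pmf (pmf_of_set {..<m}) (\<lambda>k'. Q k' k)"
      unfolding Q_def by (intro bind_pmf_cong refl bind_commute_pmf)
    finally show ?thesis .
  qed
  define P where "P k k' l = measure_pmf.prob (Q k k') {Y. dec Y \<noteq> l}" for k k' l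
  have ne: "{..<m} \<noteq> {}"
    using m by auto
  have e1: "err_prob C n m enc dec (spoof_adversary S Z n b m enc) = (\<Sum>k<m. \<Sum>k'<m. P k k' k) / (real m)\<^sup>2"
    unfolding err_prob_eq_channel_output out1 prob_bind_pmf_of_set[OF finite_lessThan ne] P_def
    by (simp add: power2_eq_square flip: sum_divide_distrib)
  have "err_prob C n m enc dec (spoof_adversary T Z n b m enc) = (\<Sum>k<m. \<Sum>k'<m. P k' k k) / (real m)\<^sup>2"
    unfolding err_prob_eq_channel_output out2 prob_bind_pmf_of_set[OF finite_lessThan ne] P_def
    by (simp add: power2_eq_square flip: sum_divide_distrib)
  \<comment> \<open>Renaming the pair makes both errors refer to the same output
    \<open>Q k k'\<close>.\<close>
  also have "\<dots> = (\<Sum>k<m. \<Sum>k'<m. P k k' k') / (real m)\<^sup>2"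
    by (subst sum.swap) simp
  finally have e2: "err_prob C n m enc dec (spoof_adversary T Z n b m enc) = (\<Sum>k<m. \<Sum>k'<m. P k k' k') / (real m)\<^sup>2" .
  have P: "P k k' k + P k k' k' \<ge> of_bool (k \<noteq> k')" for k k'
  proof (cases "k = k'")
    case False
    have "1 = measure_pmf.prob (Q k k') ({Y. dec Y \<noteq> k} \<union> {Y. dec Y \<noteq> k'})"
    proof -
      have "{Y. dec Y \<noteq> k} \<union> {Y. dec Y \<noteq> k'} = UNIV" using False by auto
      thus ?thesis by simp
    qed
    also have "\<dots> \<le> P k k' k + P k k' k'"
      unfolding P_def by (intro measure_Un_le) auto
    finally show ?thesis using False by simp
  qed (simp add: P_def)
  have "real m * (real m - 1) = (\<Sum>k<m. real m - 1)"
    by simp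
  also have "\<dots> = (\<Sum>k<m. \<Sum>k'<m. of_bool (k \<noteq> k'))"
  proof (rule sum.cong[OF refl])
    fix k assume "k \<in> {..<m}"
    have "(\<Sum>k'<m. of_bool (k \<noteq> k') :: real) = (\<Sum>k'<m. 1 - of_bool (k = k'))"
      by (intro sum.cong) auto
    also have "\<dots> = real m - 1"
      using \<open>k \<in> {..<m}\<close> by (simp add: sum_subtractf)
    finally show "real m - 1 = (\<Sum>k'<m. of_bool (k \<noteq> k'))" ..
  qed
  also have "\<dots> \<le> (\<Sum>k<m. \<Sum>k'<m. P k k' k + P k k' k')"
    by (intro sum_mono P)
  finally have "real m * (real m - 1) / (real m)\<^sup>2 \<le> (\<Sum>k<m. \<Sum>k'<m. P k k' k + P k k' k') / (real m)\<^sup>2"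
    by (intro divide_right_mono) auto
  also have "real m * (real m - 1) / (real m)\<^sup>2 = 1 - 1 / real m"
    using m by (simp add: field_simps power2_eq_square)
  finally show ?thesis
    unfolding e1 e2 by (simp add: sum.distrib add_divide_distrib)
qed

section \<open>Upper bounds on achievable rates\<close>

lemma powr_le_num_msgs: "2 powr (real b * real n * R) \<le> real (num_msgs n b R)"
  unfolding num_msgs_def by linarith

lemma num_msgs_pos: "num_msgs n b R > 0"
  using powr_le_num_msgs[of b n R] by (metis gr0I not_le of_nat_0 powr_gt_zero zero_neq_numeral)

lemma achievable_add_le:
  assumes z: "zrw + zwo \<le> C" and ach: "achievable_add C (zrw, zro, zwo) R"
  shows "R \<le> real C - real (zrw + zwo)"
proof (rule ccontr)
  define d where "d = R - (real C - real (zrw + zwo))"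
  assume "\<not> ?thesis"
  hence d: "d > 0"
    by (simp add: d_def)
  obtain N where N: "\<And>n. n \<ge> N \<Longrightarrow> \<exists>b\<ge>1. \<exists>enc dec. valid_code C n b enc \<and>
        (\<forall>A. admissible_adversary C n b (zrw, zro, zwo) A \<longrightarrow>
              err_prob C n (num_msgs n b R) enc dec A < 1 / 2)"
    using ach unfolding achievable_add_def by (metis half_gt_zero zero_less_one)
  \<comment> \<open>Once \<open>n * d\<close> is at least 1, the messages exceed what the noise lets
    through by one bit or more, which forces an error of at least 1/2.\<close>
  define n where "n = max N (nat \<lceil>1 / d\<rceil>)"
  have "1 / d \<le> real n"
    unfolding n_def by linarith
  hence nd: "1 \<le> real n * d"
    using d by (simp add: field_simps)
  obtain b enc dec where b: "b \<ge> 1" and code: "valid_code C n b enc"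
    and err: "\<And>A. admissible_adversary C n b (zrw, zro, zwo) A \<Longrightarrow> err_prob C n (num_msgs n b R) enc dec A < 1 / 2"
    using N[of n] unfolding n_def by auto
  define Zrw where "Zrw = {..<zrw}"
  define Zwo where "Zwo = {zrw..<zrw + zwo}"
  have Z: "Zrw \<union> Zwo \<subseteq> {..<C}" "Zrw \<inter> Zwo = {}" "card Zrw = zrw" "card Zwo = zwo"
    using z by (auto simp: Zrw_def Zwo_def)
  have cZ: "card (Zrw \<union> Zwo) = zrw + zwo"
    using Z by (subst card_Un_disjoint) (auto simp: Zrw_def Zwo_def)
  let ?m = "num_msgs n b R"
  have "err_prob C n ?m enc dec (noise_adversary Zrw Zwo n b) < 1 / 2"
    using Z by (intro err admissible_noise_adversary) auto
  with err_prob_noise_adversary[OF code Z(1) num_msgs_pos]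
  have "1 - 2 ^ (b * n * (C - (zrw + zwo))) / real ?m < 1 / 2"
    unfolding cZ by (meson le_less_trans)
  hence "real ?m < 2 * 2 ^ (b * n * (C - (zrw + zwo)))"
    using num_msgs_pos[of n b R] by (simp add: field_simps)
  also have "\<dots> = 2 powr (1 + real b * real n * (real C - real (zrw + zwo)))"
    using z by (simp add: powr_add powr_realpow[symmetric] of_nat_diff)
  also have "\<dots> \<le> 2 powr (real b * real n * R)"
  proof -
    have "1 \<le> real b * (real n * d)"
      using mult_mono[of 1 "real b" 1 "real n * d"] b nd by simp
    thus ?thesis
      by (simp add: d_def algebra_simps)
  qed
  also have "\<dots> \<le> real ?m"
    by (rule powr_le_num_msgs)
  finally show False
    by simp
qed

lemma achievable_add_eq_0:
  assumes z: "C \<le> zwo + 2 * zrw" and ach: "achievable_add C (zrw, zro, zwo) R"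
  shows "R = 0"
proof (rule ccontr)
  assume "R \<noteq> 0"
  hence R: "R > 0"
    using ach by (simp add: achievable_add_def)
  obtain N where N: "\<And>n. n \<ge> N \<Longrightarrow> \<exists>b\<ge>1. \<exists>enc dec. valid_code C n b enc \<and>
        (\<forall>A. admissible_adversary C n b (zrw, zro, zwo) A \<longrightarrow>
              err_prob C n (num_msgs n b R) enc dec A < 1 / 4)"
    using ach unfolding achievable_add_def by (metis zero_less_divide_1_iff zero_less_numeral)
  \<comment> \<open>A positive block length makes a positive rate mean at least two messages; then
    one of the two spoofing adversaries causes an error of at least 1/4.\<close>
  define n where "n = Suc N"
  obtain b enc dec where b: "b \<ge> 1" and code: "valid_code C n b enc"
    and err: "\<And>A. admissible_adversary C n b (zrw, zro, zwo) A \<Longrightarrow> err_prob C n (num_msgs n b R) enc dec A < 1 / 4"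
    using N[of n] unfolding n_def by auto
  \<comment> \<open>The minima cover the cases where \<open>zrw\<close> or \<open>2 * zrw\<close>
    exceeds \<open>C\<close>; the later sets then shrink or become empty.\<close>
  define S where "S = {..<min zrw C}"
  define T where "T = {min zrw C..<min (2 * zrw) C}"
  define Z where "Z = {min (2 * zrw) C..<C}"
  have part: "S \<union> T \<union> Z = {..<C}" "S \<inter> T = {}" "S \<inter> Z = {}" "T \<inter> Z = {}"
    by (auto simp: S_def T_def Z_def)
  have card: "card S \<le> zrw" "card T \<le> zrw" "card Z \<le> zwo"
    using z by (auto simp: S_def T_def Z_def)
  let ?m = "num_msgs n b R"
  have "2 powr 0 < 2 powr (real b * real n * R)"
    using b R by (intro powr_less_mono) (auto simp: n_def)
  also have "\<dots> \<le> real ?m"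
    by (rule powr_le_num_msgs)
  finally have m: "?m \<ge> 2"
    by simp
  have "err_prob C n ?m enc dec (spoof_adversary S Z n b ?m enc) < 1 / 4"
       "err_prob C n ?m enc dec (spoof_adversary T Z n b ?m enc) < 1 / 4"
    using part card m by (intro err admissible_spoof_adversary code; auto)+
  moreover have "1 - 1 / real ?m \<ge> 1 / 2"
    using m by (simp add: field_simps)
  ultimately show False
    using err_prob_spoof_adversaries[OF part code num_msgs_pos, of n b R dec] by linarith
qed

section \<open>Achievability\<close>

lemma card_power_sum_roots_less:
  fixes a :: "nat \<Rightarrow> 'a :: idom"
  assumes "l < N" "a l \<noteq> 0"
  shows "finite {x. (\<Sum>l<N. a l * x ^ l) = 0}" "card {x. (\<Sum>l<N. a l * x ^ l) = 0} < N"
proof -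
  define p where "p = (\<Sum>l<N. Polynomial.monom (a l) l)"
  have eval: "poly p x = (\<Sum>l<N. a l * x ^ l)" for x
    by (simp add: p_def poly_sum Polynomial.poly_monom)
  have coeff: "Polynomial.coeff p i = (if i < N then a i else 0)" for i
  proof -
    have "Polynomial.coeff p i = (\<Sum>l<N. if l = i then a l else 0)"
      by (simp add: p_def Polynomial.coeff_sum Polynomial.coeff_monom)
    thus ?thesis by simp
  qed
  have nz: "p \<noteq> 0"
    using assms coeff[of l] by (metis coeff_0)
  have "Polynomial.degree p < N"
  proof -
    have "Polynomial.degree p \<le> N - 1"
      using assms by (intro degree_le) (auto simp: coeff)
    thus ?thesis using assms by linarith
  qed
  thus "card {x. (\<Sum>l<N. a l * x ^ l) = 0} < N"
    using card_poly_roots_bound[OF nz] by (simp add: eval)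
  show "finite {x. (\<Sum>l<N. a l * x ^ l) = 0}"
    using poly_roots_finite[OF nz] by (simp add: eval)
qed

lemma eq_of_digits_eq:
  fixes m m' q :: nat
  assumes "m < q ^ L" "m' < q ^ L" "\<And>l. l < L \<Longrightarrow> m div q ^ l mod q = m' div q ^ l mod q"
  shows "m = m'"
  using assms
proof (induction L arbitrary: m m')
  case (Suc L)
  have "m div q = m' div q"
  proof (rule Suc.IH)
    show "m div q < q ^ L" "m' div q < q ^ L"
      using Suc.prems(1,2) by (simp_all add: less_mult_imp_div_less mult.commute)
    show "m div q div q ^ l mod q = m' div q div q ^ l mod q" if "l < L" for l
      using Suc.prems(3)[of "Suc l"] that by (simp add: div_mult2_eq)
  qed
  moreover have "m mod q = m' mod q"
    using Suc.prems(3)[of 0] by simp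
  ultimately show ?case
    by (metis div_mult_mod_eq)
qed simp

text \<open>Counting form of conditioning on all coordinates except \<open>i\<close>: each choice of
  the others leaves at most \<open>D\<close> bad values.\<close>

lemma card_PiE_coordinate_bound:
  assumes "finite I" "i \<in> I" "finite K" "x0 \<in> K"
    and fibre: "\<And>r. r \<in> PiE I (\<lambda>_. K) \<Longrightarrow> card {x\<in>K. Q (r(i := x))} \<le> D"
  shows "card {r \<in> PiE I (\<lambda>_. K). Q r} \<le> D * card K ^ (card I - 1)"
proof -
  define I' where "I' = I - {i}"
  have I: "I = insert i I'" "i \<notin> I'" "finite I'" "card I' = card I - 1"
    using assms by (auto simp: I'_def)
  have "{r \<in> PiE I (\<lambda>_. K). Q r} \<subseteq> (\<Union>g\<in>PiE I' (\<lambda>_. K). (\<lambda>x. g(i := x)) ` {x\<in>K. Q (g(i := x))})"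
    unfolding I(1) PiE_insert_eq by auto
  hence "card {r \<in> PiE I (\<lambda>_. K). Q r}
          \<le> card (\<Union>g\<in>PiE I' (\<lambda>_. K). (\<lambda>x. g(i := x)) ` {x\<in>K. Q (g(i := x))})"
    using I(3) assms(3) by (intro card_mono) (auto intro!: finite_PiE)
  also have "\<dots> \<le> (\<Sum>g\<in>PiE I' (\<lambda>_. K). card ((\<lambda>x. g(i := x)) ` {x\<in>K. Q (g(i := x))}))"
    using I(3) assms(3) by (intro card_UN_le finite_PiE) auto
  also have "\<dots> \<le> (\<Sum>g\<in>PiE I' (\<lambda>_. K). D)"
  proof (rule sum_mono)
    fix g assume g: "g \<in> PiE I' (\<lambda>_. K)"
    have "card ((\<lambda>x. g(i := x)) ` {x\<in>K. Q (g(i := x))}) \<le> card {x\<in>K. Q (g(i := x))}"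
      using assms(3) by (intro card_image_le) auto
    \<comment> \<open>The bound on fibres speaks of full tuples, so \<open>g\<close> is completed by
      the filler \<open>x0\<close>, which the update then overwrites.\<close>
    also have "\<dots> \<le> D"
      using fibre[of "g(i := x0)"] g assms(4) I(1,2) by (auto simp: PiE_fun_upd)
    finally show "card ((\<lambda>x. g(i := x)) ` {x\<in>K. Q (g(i := x))}) \<le> D" .
  qed
  also have "\<dots> = D * card K ^ (card I - 1)"
    using I(3,4) by (simp add: card_PiE)
  finally show ?thesis .
qed

section \<open>The code: Reed-Solomon symbols, keyed hashes and cubes\<close>

context xor_field
begin

text \<open>A Reed-Solomon code in each time slot; its coefficients are the base \<open>2 ^ b\<close> digits of the message.\<close>
definition body :: "nat \<Rightarrow> nat \<Rightarrow> nat \<Rightarrow> nat \<Rightarrow> 'a" where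
  "body k m i t = (\<Sum>l<k. d (m div (2 ^ b) ^ (t * k + l) mod 2 ^ b) * d i ^ l)"

text \<open>The exponents start at 1, so an additive shift of the transmitted hash, being a constant
  term, cannot cancel a difference between two message parts.\<close>

definition hash :: "nat \<Rightarrow> (nat \<Rightarrow> 'a) \<Rightarrow> 'a \<Rightarrow> 'a" where
  "hash N x r = (\<Sum>t<N. x t * r ^ Suc t)"

lemma body_mem: "i < 2 ^ b \<Longrightarrow> body k m i t \<in> K"
  unfolding body_def by (intro sum_mem mult_mem power_mem d_mem) auto

lemma hash_mem: "(\<And>t. t < N \<Longrightarrow> x t \<in> K) \<Longrightarrow> r \<in> K \<Longrightarrow> hash N x r \<in> K"
  unfolding hash_def by (intro sum_mem mult_mem power_mem) auto

lemma hash_cong: "(\<And>t. t < N \<Longrightarrow> x t = y t) \<Longrightarrow> hash N x r = hash N y r"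
  by (simp add: hash_def)

text \<open>In each slot the difference of two codewords is a polynomial with \<open>k\<close>
  coefficients that vanishes at \<open>card G\<close> distinct points, hence is zero. All digits of
  the two messages agree.\<close>

lemma body_determines_message:
  assumes G: "finite G" "G \<subseteq> {..<2 ^ b}" "k \<le> card G"
    and m: "m < (2 ^ b) ^ (N * k)" "m' < (2 ^ b) ^ (N * k)"
    and eq: "\<And>j t. j \<in> G \<Longrightarrow> t < N \<Longrightarrow> body k m j t = body k m' j t"
  shows "m = m'"
proof (rule eq_of_digits_eq[OF m])
  fix s assume s: "s < N * k"
  \<comment> \<open>Digit \<open>s\<close> is coefficient \<open>l\<close> of slot
    \<open>t\<close>.\<close>
  define t where "t = s div k"
  define l where "l = s mod k"
  have k: "k > 0"
    using s by (cases k) auto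
  have tl: "t < N" "l < k" "s = t * k + l"
    using s k by (auto simp: t_def l_def less_mult_imp_div_less)
  define a where "a l = d (m div (2 ^ b) ^ (t * k + l) mod 2 ^ b) - d (m' div (2 ^ b) ^ (t * k + l) mod 2 ^ b)" for l
  have "a l = 0"
  proof (rule ccontr)
    assume nz: "a l \<noteq> 0"
    have "d ` G \<subseteq> {x. (\<Sum>l<k. a l * x ^ l) = 0}"
    proof safe
      fix j assume "j \<in> G"
      thus "(\<Sum>l<k. a l * d j ^ l) = 0"
        using eq[of j t] tl by (simp add: a_def left_diff_distrib sum_subtractf body_def)
    qed
    hence "card (d ` G) < k"
      using card_power_sum_roots_less[OF tl(2), of a] nz by (meson card_mono le_less_trans)
    moreover have "card (d ` G) = card G"
      using G(2) by (intro card_image inj_onI) (auto intro: d_inj)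
    ultimately show False
      using G(3) by simp
  qed
  thus "m div (2 ^ b) ^ s mod 2 ^ b = m' div (2 ^ b) ^ s mod 2 ^ b"
    unfolding a_def tl(3) by (intro d_inj) auto
qed

lemma card_hash_collisions:
  assumes "t < N" "y t \<noteq> x t"
  shows "card {r \<in> K. hash N y r = hash N x r + c} \<le> N"
proof -
  \<comment> \<open>The coefficient of degree \<open>Suc t\<close> is nonzero whatever the shift
    \<open>c\<close>, and the degree is at most \<open>N\<close>.\<close>
  define a where "a l = (case l of 0 \<Rightarrow> - c | Suc t \<Rightarrow> y t - x t)" for l
  have "(\<Sum>l<Suc N. a l * r ^ l) = hash N y r - hash N x r - c" for r
    by (subst sum.lessThan_Suc_shift)
       (simp add: a_def hash_def left_diff_distrib sum_subtractf del: power_Suc)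
  hence "{r \<in> K. hash N y r = hash N x r + c} \<subseteq> {r. (\<Sum>l<Suc N. a l * r ^ l) = 0}"
    by auto
  moreover have "Suc t < Suc N" "a (Suc t) \<noteq> 0"
    using assms by (auto simp: a_def)
  note card_power_sum_roots_less[of "Suc t" "Suc N" a, OF this]
  ultimately show ?thesis
    by (meson card_mono le_less_trans less_Suc_eq_le)
qed

text \<open>Unlike squaring, cubing is not additive in characteristic 2, so it reveals a shifted key.\<close>
lemma card_cube_collisions:
  assumes "s \<in> K" "s \<noteq> 0"
  shows "card {r \<in> K. (r + s) ^ 3 = r ^ 3 + c} \<le> 2"
proof -
  define a where "a = (\<lambda>l::nat. if l = 0 then s ^ 3 - c else if l = 1 then 3 * s ^ 2 else 3 * s)"
  have "(\<Sum>l<3. a l * r ^ l) = (r + s) ^ 3 - r ^ 3 - c" for r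
    by (simp add: a_def numeral_3_eq_3 algebra_simps power2_eq_square)
  hence "{r \<in> K. (r + s) ^ 3 = r ^ 3 + c} \<subseteq> {r. (\<Sum>l<3. a l * r ^ l) = 0}"
    by auto
  \<comment> \<open>In characteristic 2 the leading coefficient \<open>3 * s\<close> of the
    quadratic is \<open>s\<close> itself.\<close>
  moreover have "3 * s = s + (s + s)"
    by simp
  hence "a 2 \<noteq> 0"
    using double_zero[OF assms(1)] assms(2) by (simp add: a_def)
  hence "finite {x. (\<Sum>l<3. a l * x ^ l) = 0}" "card {x. (\<Sum>l<3. a l * x ^ l) = 0} < 3"
    using card_power_sum_roots_less[of 2 3 a] by auto
  ultimately have "card {r \<in> K. (r + s) ^ 3 = r ^ 3 + c} < 3"
    by (meson card_mono le_less_trans)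
  thus ?thesis by simp
qed

text \<open>\<open>s\<close>, \<open>c\<close> and \<open>c'\<close> are shifts of the key, its cube
  and the hash. An unshifted key leaves a hash collision with at most \<open>N\<close> solutions. A
  shifted one leaves the cube equation with at most 2, and 2 is within \<open>Suc N\<close> because
  \<open>t < N\<close>.\<close>

lemma card_tag_collisions:
  assumes "t < N" "y t \<noteq> x t" "s \<in> K"
  shows "card {r \<in> K. (r + s) ^ 3 = r ^ 3 + c \<and> hash N y (r + s) = hash N x r + c'} \<le> Suc N"
proof (cases "s = 0")
  case True
  have "card {r \<in> K. (r + s) ^ 3 = r ^ 3 + c \<and> hash N y (r + s) = hash N x r + c'}
      \<le> card {r \<in> K. hash N y r = hash N x r + c'}"
    using True finite_K by (intro card_mono) auto
  thus ?thesis
    using card_hash_collisions[of t N y x c'] assms by simp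
next
  case False
  have "card {r \<in> K. (r + s) ^ 3 = r ^ 3 + c \<and> hash N y (r + s) = hash N x r + c'}
      \<le> card {r \<in> K. (r + s) ^ 3 = r ^ 3 + c}"
    using finite_K by (intro card_mono) auto
  thus ?thesis
    using card_cube_collisions[of s c] assms False by simp
qed

text \<open>The key and the tags come last, so that a causal adversary must jam the message part before he
  sees any key.\<close>
definition link_symbol :: "nat \<Rightarrow> nat \<Rightarrow> nat \<Rightarrow> 'a \<Rightarrow> nat \<Rightarrow> nat \<Rightarrow> 'a" where
  "link_symbol N k m r i t =
     (if t < N then body k m i t else if t = N then r else if t = Suc N then r ^ 3
      else hash N (body k m (t - (N + 2))) r)"

text \<open>Key, cube and one hash per link take \<open>C + 2\<close> slots. This overhead does not
  grow with \<open>N\<close>, so it costs no rate in the limit.\<close>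

definition codeword :: "nat \<Rightarrow> nat \<Rightarrow> nat \<Rightarrow> nat \<Rightarrow> (nat \<Rightarrow> 'a) \<Rightarrow> word" where
  "codeword C N k m r =
     (\<lambda>i t. if i < C \<and> t < N + 2 + C then e (link_symbol N k m (r i) i t) else 0)"

text \<open>Link \<open>i\<close> vouches for link \<open>j\<close>, judged by received values
  only.\<close>

definition passes :: "nat \<Rightarrow> (nat \<Rightarrow> nat \<Rightarrow> 'a) \<Rightarrow> nat \<Rightarrow> nat \<Rightarrow> bool" where
  "passes N y i j \<longleftrightarrow> y i (Suc N) = y i N ^ 3 \<and> y i (N + 2 + j) = hash N (y j) (y i N)"

text \<open>The threshold \<open>k\<close> will be the guaranteed number of unjammed links, so Bob
  need not know which links they are.\<close>

definition accepted :: "nat \<Rightarrow> nat \<Rightarrow> nat \<Rightarrow> (nat \<Rightarrow> nat \<Rightarrow> 'a) \<Rightarrow> nat set" where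
  "accepted C N k y = {j. j < C \<and> k \<le> card {i. i < C \<and> passes N y i j}}"

text \<open>The choice is unambiguous as soon as the accepted links are uncorrupted and number at
  least \<open>k\<close>.\<close>

definition decode :: "nat \<Rightarrow> nat \<Rightarrow> nat \<Rightarrow> word \<Rightarrow> nat" where
  "decode C N k Y = (let y = (\<lambda>i t. d (Y i t)) in
     SOME m. m < (2 ^ b) ^ (N * k) \<and> (\<forall>j\<in>accepted C N k y. \<forall>t<N. body k m j t = y j t))"

definition encode :: "nat \<Rightarrow> nat \<Rightarrow> nat \<Rightarrow> nat \<Rightarrow> word pmf" where
  "encode C N k m = map_pmf (codeword C N k m) (pmf_of_set (PiE {..<C} (\<lambda>_. K)))"

lemma link_symbol_mem:
  assumes "C \<le> 2 ^ b" "i < C" "t < N + 2 + C" "r \<in> K"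
  shows "link_symbol N k m r i t \<in> K"
  using assms unfolding link_symbol_def by (auto intro!: body_mem hash_mem power_mem)

lemma keys_finite_nonempty: "finite (PiE {..<C::nat} (\<lambda>_. K))" "PiE {..<C} (\<lambda>_. K) \<noteq> {}"
  using finite_K zero_mem by (auto intro!: finite_PiE simp: PiE_eq_empty_iff)

lemma valid_code_encode:
  assumes "C \<le> 2 ^ b"
  shows "valid_code C (N + 2 + C) b (encode C N k)"
proof -
  have "link_symbol N k m (r i) i t \<in> K" if "r \<in> PiE {..<C} (\<lambda>_. K)" "i < C" "t < N + 2 + C" for m r i t
    using that assms by (intro link_symbol_mem) auto
  thus ?thesis
    using keys_finite_nonempty[of C] by (auto simp: valid_code_def valid_word_def encode_def codeword_def intro!: e_less)
qed

section \<open>Error analysis against one deterministic strategy\<close>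

context
  fixes C N k zrw zro zwo m :: nat and Zrw Zro Zwo :: "nat set" and J :: "word \<Rightarrow> word"
  assumes C: "C \<le> 2 ^ b" and strategy: "admissible_strategy C (N + 2 + C) b (zrw, zro, zwo) (Zrw, Zro, Zwo, J)"
begin

definition seen :: "(nat \<Rightarrow> 'a) \<Rightarrow> nat \<Rightarrow> nat \<Rightarrow> 'a" where
  "seen r i t = d (received C (N + 2 + C) (codeword C N k m r) (J (codeword C N k m r)) i t)"

text \<open>The bad event: link \<open>j\<close> arrives with a corrupted message part, yet link
  \<open>i\<close> vouches for it.\<close>

definition undetected :: "(nat \<Rightarrow> 'a) \<Rightarrow> nat \<Rightarrow> nat \<Rightarrow> bool" where
  "undetected r i j \<longleftrightarrow> (\<exists>t<N. seen r j t \<noteq> body k m j t) \<and> passes N (seen r) i j"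

lemma seen_eq:
  assumes "i < C" "t < N + 2 + C" "r i \<in> K"
  shows "seen r i t = link_symbol N k m (r i) i t + d (J (codeword C N k m r) i t)"
proof -
  have "J (codeword C N k m r) i t < 2 ^ b"
    using strategy by (simp add: admissible_strategy_def)
  thus ?thesis
    using assms link_symbol_mem[OF C, of i t N "r i" k m] by (simp add: seen_def received_def codeword_def d_xor)
qed

text \<open>Fix all keys except that of \<open>i\<close>. The errors on the message part of
  \<open>j\<close> and all errors on \<open>i\<close> do not depend on the remaining key, so they
  are constants and \<open>card_tag_collisions\<close> bounds the bad keys.\<close>

lemma card_undetected:
  assumes i: "i < C" "i \<notin> Zrw" and j: "j < C"
  shows "card {r \<in> PiE {..<C} (\<lambda>_. K). undetected r i j} \<le> Suc N * (2 ^ b) ^ (C - 1)"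
proof -
  have "card {x\<in>K. undetected (r(i := x)) i j} \<le> Suc N" if r: "r \<in> PiE {..<C} (\<lambda>_. K)" for r
  proof -
    define w where "w x = codeword C N k m (r(i := x))" for x
    have rK: "(r(i := x)) i' \<in> K" if "x \<in> K" "i' < C" for x i'
      using r that by auto
    have causal: "J w1 i' t = J w2 i' t" if "\<forall>j'\<in>Zrw \<union> Zro. \<forall>s\<le>t. w1 j' s = w2 j' s" for w1 w2 i' t
      using strategy that unfolding admissible_strategy_def by auto
    \<comment> \<open>Keys enter the codeword only from time \<open>N\<close> on, so during the
      message slots Calvin acts as if the key of \<open>i\<close> were the reference value
      0.\<close>
    have Jb: "J (w x) j t = J (w 0) j t" if "t < N" for x t
      using that by (intro causal) (auto simp: w_def codeword_def link_symbol_def)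
    \<comment> \<open>A write-only link is never read, and neither its key nor its tags appear on
      other links; a link outside \<open>Zrw\<close> and \<open>Zwo\<close> carries no error at
      all.\<close>
    have Ji: "J (w x) i t = J (w 0) i t" for x t
    proof (cases "i \<in> Zwo")
      case True
      hence "i \<notin> Zrw \<union> Zro"
        using strategy i unfolding admissible_strategy_def by auto
      thus ?thesis
        by (intro causal) (auto simp: w_def codeword_def)
    next
      case False
      thus ?thesis
        using strategy i unfolding admissible_strategy_def by auto
    qed
    have Jless: "J w' i' t < 2 ^ b" for w' i' t
      using strategy by (simp add: admissible_strategy_def)
    define y where "y t = body k m j t + d (J (w 0) j t)" for t
    have body: "seen (r(i := x)) j t = y t" if "x \<in> K" "t < N" for x t
      using that j rK Jb[of t x] unfolding y_def
      by (subst seen_eq) (auto simp: w_def link_symbol_def)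
    show ?thesis
    proof (cases "\<exists>t<N. y t \<noteq> body k m j t")
      case False
      hence "{x\<in>K. undetected (r(i := x)) i j} = {}"
        using body unfolding undetected_def by auto
      thus ?thesis by (simp only: card.empty zero_le)
    next
      case True
      then obtain t where t: "t < N" "y t \<noteq> body k m j t" by blast
      define E where "E t = d (J (w 0) i t)" for t
      have E: "seen (r(i := x)) i t = link_symbol N k m x i t + E t" if "x \<in> K" "t < N + 2 + C" for x t
        using that i rK Ji[of x t] unfolding E_def by (subst seen_eq) (auto simp: w_def)
      have "{x\<in>K. undetected (r(i := x)) i j} \<subseteq>
         {x \<in> K. (x + E N) ^ 3 = x ^ 3 + E (Suc N) \<and> hash N y (x + E N) = hash N (body k m j) x + E (N + 2 + j)}"
      proof safe
        fix x assume x: "x \<in> K" and "undetected (r(i := x)) i j"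
        hence *: "seen (r(i := x)) i (Suc N) = seen (r(i := x)) i N ^ 3"
          "seen (r(i := x)) i (N + 2 + j) = hash N (seen (r(i := x)) j) (seen (r(i := x)) i N)"
          by (auto simp: undetected_def passes_def)
        have EN: "seen (r(i := x)) i N = x + E N"
          using E[OF x, of N] by (simp add: link_symbol_def)
        show "(x + E N) ^ 3 = x ^ 3 + E (Suc N)"
          using *(1) E[OF x, of "Suc N"] i by (simp add: link_symbol_def EN)
        have "hash N y (x + E N) = hash N (seen (r(i := x)) j) (x + E N)"
          by (rule hash_cong) (simp add: body x)
        thus "hash N y (x + E N) = hash N (body k m j) x + E (N + 2 + j)"
          using *(2) E[OF x, of "N + 2 + j"] j by (simp add: link_symbol_def EN)
      qed
      hence "card {x\<in>K. undetected (r(i := x)) i j} \<le> card {x \<in> K. (x + E N) ^ 3 = x ^ 3 + E (Suc N) \<and> hash N y (x + E N) = hash N (body k m j) x + E (N + 2 + j)}"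
        using finite_K by (intro card_mono) auto
      also have "\<dots> \<le> Suc N"
        by (rule card_tag_collisions[of t N y "body k m j", OF t]) (simp add: E_def d_mem Jless)
      finally show ?thesis .
    qed
  qed
  from card_PiE_coordinate_bound[where Q = "\<lambda>r. undetected r i j" and i = i and I = "{..<C}", OF _ _ finite_K zero_mem this] i
  show ?thesis
    by (simp add: card_K)
qed

text \<open>The unjammed links \<open>G\<close> vouch for one another, so all are accepted. An
  accepted link has at least \<open>k > zrw\<close> vouchers, one of them outside
  \<open>Zrw\<close>, and by \<open>good\<close> that voucher certifies its message part. Hence at
  least \<open>k\<close> correct links determine \<open>m\<close>.\<close>

lemma decode_correct:
  assumes k: "k = C - (zrw + zwo)" "zrw < k" and m: "m < (2 ^ b) ^ (N * k)"
    and r: "r \<in> PiE {..<C} (\<lambda>_. K)"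
    and good: "\<And>i j. i < C \<Longrightarrow> i \<notin> Zrw \<Longrightarrow> j < C \<Longrightarrow> \<not> undetected r i j"
  shows "decode C N k (received C (N + 2 + C) (codeword C N k m r) (J (codeword C N k m r))) = m"
proof -
  have seen_def': "(\<lambda>i t. d (received C (N + 2 + C) (codeword C N k m r) (J (codeword C N k m r)) i t)) = seen r"
    by (simp add: seen_def fun_eq_iff)
  define A where "A = accepted C N k (seen r)"
  define G where "G = {..<C} - (Zrw \<union> Zwo)"
  have Z: "Zrw \<subseteq> {..<C}" "Zwo \<subseteq> {..<C}" "Zrw \<inter> Zwo = {}" "card Zrw \<le> zrw" "card Zwo \<le> zwo"
    using strategy by (auto simp: admissible_strategy_def)
  have fin: "finite Zrw" "finite Zwo"
    using Z finite_subset by blast+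
  have "card (Zrw \<union> Zwo) \<le> zrw + zwo"
    using card_Un_le[of Zrw Zwo] Z by linarith
  moreover have "card G = C - card (Zrw \<union> Zwo)"
    unfolding G_def using fin Z by (subst card_Diff_subset) auto
  ultimately have cG: "k \<le> card G"
    using k by linarith
  have clean: "seen r i t = link_symbol N k m (r i) i t" if "i \<in> G" "t < N + 2 + C" for i t
  proof -
    have "J (codeword C N k m r) i t = 0"
      using strategy that unfolding admissible_strategy_def G_def by auto
    thus ?thesis
      using that r by (subst seen_eq) (auto simp: G_def d_zero)
  qed
  have "passes N (seen r) i j" if "i \<in> G" "j \<in> G" for i j
  proof -
    have "hash N (seen r j) (r i) = hash N (body k m j) (r i)"
      using that by (intro hash_cong) (simp add: clean link_symbol_def)
    thus ?thesis
      using that by (auto simp: passes_def clean link_symbol_def G_def)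
  qed
  hence "G \<subseteq> {i. i < C \<and> passes N (seen r) i j}" if "j \<in> G" for j
    using that by (auto simp: G_def)
  hence "k \<le> card {i. i < C \<and> passes N (seen r) i j}" if "j \<in> G" for j
    using that by (intro order_trans[OF cG] card_mono) auto
  hence GA: "G \<subseteq> A"
    by (auto simp: A_def accepted_def G_def)
  have A: "finite A" "A \<subseteq> {..<2 ^ b}"
    unfolding A_def accepted_def using C by auto
  have cA: "k \<le> card A"
    using cG card_mono[OF A(1) GA] by linarith
  have bodyA: "body k m j t = seen r j t" if "j \<in> A" "t < N" for j t
  proof -
    have "\<not> {i. i < C \<and> passes N (seen r) i j} \<subseteq> Zrw"
    proof
      assume "{i. i < C \<and> passes N (seen r) i j} \<subseteq> Zrw"
      hence "card {i. i < C \<and> passes N (seen r) i j} \<le> card Zrw"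
        using fin by (intro card_mono)
      thus False
        using that k Z by (auto simp: A_def accepted_def)
    qed
    then obtain i where "i < C" "i \<notin> Zrw" "passes N (seen r) i j"
      by auto
    thus ?thesis
      using good[of i j] that by (auto simp: undetected_def A_def accepted_def)
  qed
  show ?thesis
    unfolding decode_def seen_def' Let_def A_def[symmetric]
  proof (rule some_equality)
    show "m < (2 ^ b) ^ (N * k) \<and> (\<forall>j\<in>A. \<forall>t<N. body k m j t = seen r j t)"
      using m bodyA by blast
    fix m' assume m': "m' < (2 ^ b) ^ (N * k) \<and> (\<forall>j\<in>A. \<forall>t<N. body k m' j t = seen r j t)"
    show "m' = m"
      by (rule body_determines_message[OF A cA]) (use m m' bodyA in auto)
  qed
qed

text \<open>Union bound over the pairs \<open>(i, j)\<close>, divided by the number of key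
  tuples.\<close>

lemma prob_decode_wrong:
  assumes k: "k = C - (zrw + zwo)" "zrw < k" and m: "m < (2 ^ b) ^ (N * k)"
  shows "measure_pmf.prob (encode C N k m)
           {w. decode C N k (received C (N + 2 + C) w (J w)) \<noteq> m} \<le> real (C\<^sup>2 * Suc N) / 2 ^ b"
proof -
  let ?R = "PiE {..<C} (\<lambda>_. K)"
  define B where "B = {r \<in> ?R. \<exists>i\<in>{..<C}. \<exists>j\<in>{..<C}. i \<notin> Zrw \<and> undetected r i j}"
  have C0: "C > 0"
    using k by auto
  have "card (?R \<inter> codeword C N k m -` {w. decode C N k (received C (N + 2 + C) w (J w)) \<noteq> m}) \<le> card B"
  proof (rule card_mono)
    show "finite B"
      using keys_finite_nonempty(1)[of C] by (simp add: B_def)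
    show "?R \<inter> codeword C N k m -` {w. decode C N k (received C (N + 2 + C) w (J w)) \<noteq> m} \<subseteq> B"
    proof
      fix r assume r: "r \<in> ?R \<inter> codeword C N k m -` {w. decode C N k (received C (N + 2 + C) w (J w)) \<noteq> m}"
      show "r \<in> B"
      proof (rule ccontr)
        assume "r \<notin> B"
        hence "\<not> undetected r i j" if "i < C" "i \<notin> Zrw" "j < C" for i j
          using r that by (auto simp: B_def)
        from decode_correct[OF k m _ this] r show False
          by blast
      qed
    qed
  qed
  also have "B \<subseteq> (\<Union>(i, j)\<in>({..<C} - Zrw) \<times> {..<C}. {r \<in> ?R. undetected r i j})"
    unfolding B_def by auto
  hence "card B \<le> card (\<Union>(i, j)\<in>({..<C} - Zrw) \<times> {..<C}. {r \<in> ?R. undetected r i j})"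
    using keys_finite_nonempty(1)[of C] by (intro card_mono) auto
  also have "\<dots> \<le> (\<Sum>(i, j)\<in>({..<C} - Zrw) \<times> {..<C}. card {r \<in> ?R. undetected r i j})"
    by (rule order_trans[OF card_UN_le]) (auto simp: case_prod_unfold)
  also have "\<dots> \<le> (\<Sum>(i, j)\<in>({..<C} - Zrw) \<times> {..<C}. Suc N * (2 ^ b) ^ (C - 1))"
    by (intro sum_mono) (use card_undetected in \<open>auto simp del: mult_Suc One_nat_def\<close>)
  also have "\<dots> \<le> C\<^sup>2 * (Suc N * (2 ^ b) ^ (C - 1))"
    using card_mono[of "{..<C}" "{..<C} - Zrw"]
    by (simp add: case_prod_unfold card_cartesian_product power2_eq_square del: mult_Suc)
  finally have le: "card (?R \<inter> codeword C N k m -` {w. decode C N k (received C (N + 2 + C) w (J w)) \<noteq> m})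
      \<le> C\<^sup>2 * Suc N * (2 ^ b) ^ (C - 1)"
    by (simp only: mult.assoc)
  have "measure_pmf.prob (encode C N k m) {w. decode C N k (received C (N + 2 + C) w (J w)) \<noteq> m}
     = real (card (?R \<inter> codeword C N k m -` {w. decode C N k (received C (N + 2 + C) w (J w)) \<noteq> m})) / (2 ^ b) ^ C"
    using keys_finite_nonempty[of C] by (simp add: encode_def measure_pmf_of_set card_PiE card_K)
  also have "\<dots> \<le> real (C\<^sup>2 * Suc N * (2 ^ b) ^ (C - 1)) / (2 ^ b) ^ C"
    using le by (intro divide_right_mono) (simp_all only: of_nat_le_iff zero_le_power zero_le_numeral)
  also have "\<dots> = real (C\<^sup>2 * Suc N) / 2 ^ b"
    using C0 by (cases C) (auto simp: field_simps)
  finally show ?thesis .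
qed

end

text \<open>Calvin's strategy is drawn independently of Alice's keys, so one may condition on it and
  use the bound for each deterministic strategy.\<close>

lemma err_prob_encode:
  assumes C: "C \<le> 2 ^ b" and k: "k = C - (zrw + zwo)" "zrw < k"
    and M: "M > 0" "M \<le> (2 ^ b) ^ (N * k)"
    and A: "admissible_adversary C (N + 2 + C) b (zrw, zro, zwo) A"
  shows "err_prob C (N + 2 + C) M (encode C N k) (decode C N k) A \<le> real (C\<^sup>2 * Suc N) / 2 ^ b"
proof -
  have "measure_pmf.prob (channel_output C (N + 2 + C) (encode C N k) A m) {Y. decode C N k Y \<noteq> m}
          \<le> real (C\<^sup>2 * Suc N) / 2 ^ b" if "m < M" for m
  proof -
    have "channel_output C (N + 2 + C) (encode C N k) A m =
        bind_pmf A (\<lambda>s. map_pmf (\<lambda>w. received C (N + 2 + C) w (snd (snd (snd s)) w)) (encode C N k m))"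
      unfolding channel_output_def pair_pmf_def map_pmf_def
      by (subst bind_commute_pmf) (simp add: bind_assoc_pmf bind_return_pmf)
    moreover have "measure_pmf.prob (map_pmf (\<lambda>w. received C (N + 2 + C) w (snd (snd (snd s)) w)) (encode C N k m))
        {Y. decode C N k Y \<noteq> m} \<le> real (C\<^sup>2 * Suc N) / 2 ^ b" if s: "s \<in> set_pmf A" for s
    proof -
      obtain Zrw Zro Zwo J where sJ: "s = (Zrw, Zro, Zwo, J)"
        by (cases s)
      have "admissible_strategy C (N + 2 + C) b (zrw, zro, zwo) (Zrw, Zro, Zwo, J)"
        using A s unfolding sJ admissible_adversary_def by auto
      from prob_decode_wrong[OF C this k] \<open>m < M\<close> M(2)
      show ?thesis
        unfolding sJ by (simp add: vimage_def)
    qed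
    ultimately show ?thesis
      by (auto intro!: prob_bind_pmf_le)
  qed
  hence "(\<Sum>m<M. measure_pmf.prob (channel_output C (N + 2 + C) (encode C N k) A m) {Y. decode C N k Y \<noteq> m})
      \<le> (\<Sum>m<M. real (C\<^sup>2 * Suc N) / 2 ^ b)"
    by (intro sum_mono) auto
  thus ?thesis
    using M(1) unfolding err_prob_eq_channel_output by (simp add: field_simps)
qed

end

section \<open>Achievable rates and the capacity\<close>

text \<open>The gap to capacity pays for the overhead of \<open>C + 2\<close> slots in long blocks;
  the field size, chosen after \<open>n\<close>, makes the error small.\<close>

lemma achievable_add_below_capacity:
  assumes z: "zwo + 2 * zrw < C" and R: "0 \<le> R" "R < real C - real (zrw + zwo)"
  shows "achievable_add C (zrw, zro, zwo) R"
  unfolding achievable_add_def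
proof (intro conjI allI impI R(1))
  fix \<epsilon> :: real assume \<epsilon>: "\<epsilon> > 0"
  define k where "k = C - (zrw + zwo)"
  have k: "zrw < k" "real k = real C - real (zrw + zwo)"
    using z by (auto simp: k_def of_nat_diff)
  define gap where "gap = real k - R"
  have gap: "gap > 0"
    using R k by (simp add: gap_def)
  \<comment> \<open>This makes \<open>n * R\<close> at most \<open>(n - (C + 2)) * k\<close>, so
    that the messages fit into the message slots.\<close>
  define N0 where "N0 = C + 2 + nat \<lceil>real k * real (C + 2) / gap\<rceil>"
  have "\<exists>b\<ge>1. \<exists>enc dec. valid_code C n b enc \<and>
        (\<forall>A. admissible_adversary C n b (zrw, zro, zwo) A \<longrightarrow>
              err_prob C n (num_msgs n b R) enc dec A < \<epsilon>)" if n: "n \<ge> N0" for n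
  proof -
    define N where "N = n - (C + 2)"
    have nN: "n = N + 2 + C"
      using n by (simp add: N_def N0_def)
    have "real k * real (C + 2) / gap \<le> real n"
      using n unfolding N0_def by linarith
    hence "real k * real (C + 2) \<le> real n * (real k - R)"
      using gap by (simp add: field_simps gap_def)
    hence rate: "real n * R \<le> real (N * k)"
      unfolding nN by (simp add: algebra_simps)
    \<comment> \<open>The field must offer \<open>C\<close> distinct evaluation points and push the
      error bound below \<epsilon>.\<close>
    obtain b0 :: nat where b0: "real C + real (C\<^sup>2 * Suc N) / \<epsilon> < 2 ^ b0"
      using real_arch_pow[of 2] by auto
    define b where "b = Suc b0"
    have b: "real C + real (C\<^sup>2 * Suc N) / \<epsilon> < 2 ^ b"
      using b0 zero_less_power[of "2::real" b0] unfolding b_def power_Suc by linarith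
    have "real (C\<^sup>2 * Suc N) / \<epsilon> \<ge> 0"
      using \<epsilon> by simp
    hence "real C \<le> 2 ^ b"
      using b by linarith
    hence bC: "C \<le> 2 ^ b"
      by (metis of_nat_le_iff of_nat_numeral of_nat_power)
    have "real (C\<^sup>2 * Suc N) / \<epsilon> < 2 ^ b"
      using b by linarith
    hence small: "real (C\<^sup>2 * Suc N) / 2 ^ b < \<epsilon>"
      using \<epsilon> by (simp add: field_simps)
    have "b > 0"
      by (simp add: b_def)
    then obtain K :: "bit alg_closure set" and e where "xor_field K e b"
      using exists_xor_field by blast
    then interpret xor_field K e b .
    have "2 powr (real b * real n * R) \<le> 2 powr real (b * (N * k))"
      using rate by (intro powr_mono) (simp_all add: mult.assoc mult_left_mono)
    also have "\<dots> = real ((2 ^ b) ^ (N * k))"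
      by (subst powr_realpow) (simp_all add: power_mult)
    finally have M: "num_msgs n b R \<le> (2 ^ b) ^ (N * k)"
      unfolding num_msgs_def by (simp add: nat_le_iff ceiling_le_iff)
    have "err_prob C n (num_msgs n b R) (encode C N k) (decode C N k) A < \<epsilon>"
      if "admissible_adversary C n b (zrw, zro, zwo) A" for A
      using err_prob_encode[OF bC k_def k(1) num_msgs_pos M] that small unfolding nN
      by (meson le_less_trans)
    moreover have "valid_code C n b (encode C N k)"
      unfolding nN by (rule valid_code_encode[OF bC])
    moreover have "b \<ge> 1"
      by (simp add: b_def)
    ultimately show ?thesis
      by blast
  qed
  thus "\<exists>N. \<forall>n\<ge>N. \<exists>b\<ge>1. \<exists>enc dec. valid_code C n b enc \<and>
        (\<forall>A. admissible_adversary C n b (zrw, zro, zwo) A \<longrightarrow>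
              err_prob C n (num_msgs n b R) enc dec A < \<epsilon>)"
    by blast
qed

text \<open>At rate 0 there is a single message, which a constant decoder gets right. This keeps the
  supremum in the degenerate case from being taken over the empty set.\<close>

lemma achievable_add_0: "achievable_add C z 0"
  unfolding achievable_add_def
proof (intro conjI allI impI exI)
  fix \<epsilon> :: real and n :: nat and A
  assume "\<epsilon> > 0"
  show "valid_code C n 1 (\<lambda>_. return_pmf (\<lambda>_ _. 0))"
    by (simp add: valid_code_def valid_word_def)
  show "err_prob C n (num_msgs n 1 0) (\<lambda>_. return_pmf (\<lambda>_ _. 0)) (\<lambda>_. 0) A < \<epsilon>"
    using \<open>\<epsilon> > 0\<close> by (simp add: num_msgs_def err_prob_def)
qed auto

theorem theorem1:
  fixes C zrw zro zwo :: nat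
  assumes "zrw + zro + zwo \<le> C"
  shows "capacity_add C (zrw, zro, zwo) =
           ereal (if zwo + 2 * zrw < C then real C - real (zrw + zwo) else 0)"
proof (cases "zwo + 2 * zrw < C")
  case True
  define c where "c = real C - real (zrw + zwo)"
  have "c > 0"
    using True by (simp add: c_def)
  have "capacity_add C (zrw, zro, zwo) = ereal c"
    unfolding capacity_add_def
  proof (rule antisym)
    show "Sup (ereal ` {R. achievable_add C (zrw, zro, zwo) R}) \<le> ereal c"
      using achievable_add_le[of zrw zwo C zro] assms by (auto simp: c_def intro!: SUP_least)
    show "ereal c \<le> Sup (ereal ` {R. achievable_add C (zrw, zro, zwo) R})"
    proof (rule dense_le)
      fix y assume y: "y < ereal c"
      then obtain R where R: "y < ereal R" "R < c"
        by (metis ereal_dense2 less_ereal.simps(1))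
      \<comment> \<open>Achievable rates are nonnegative, so \<open>R\<close> is cut off at 0; it
        stays below \<open>c\<close> because \<open>c > 0\<close>.\<close>
      define R' where "R' = max 0 R"
      have "achievable_add C (zrw, zro, zwo) R'"
        using True R \<open>c > 0\<close> by (intro achievable_add_below_capacity) (auto simp: R'_def c_def)
      hence "ereal R' \<le> Sup (ereal ` {R. achievable_add C (zrw, zro, zwo) R})"
        by (intro SUP_upper) simp
      moreover have "y \<le> ereal R'"
        by (rule order_trans[OF less_imp_le[OF R(1)]]) (simp add: R'_def)
      ultimately show "y \<le> Sup (ereal ` {R. achievable_add C (zrw, zro, zwo) R})"
        by (rule order_trans[rotated])
    qed
  qed
  thus ?thesis
    using True by (simp add: c_def)
next
  case False
  hence "{R. achievable_add C (zrw, zro, zwo) R} = {0}"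
    using achievable_add_eq_0[of C zwo zrw zro] achievable_add_0[of C] by auto
  thus ?thesis
    using False by (simp add: capacity_add_def)
qed

end
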